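(* For every open subset $U$ of some Euclidean space, the $D$-topology on the free diffeological vector space $F(U)$ makes it a normal topological vector space.
   Context: All vector spaces are over $\mathbb{R}$. A diffeological space is a set $X$ with a collection of maps $W\to X$ (called plots), where $W$ ranges over open subsets of $\mathbb{R}^n$, $n\in\mathbb{N}$ arbitrary, such that: every constant map is a plot; the precomposition of a plot with a smooth map between open subsets of Euclidean spaces is a plot; a map that restricts to a plot on each member of some open cover of its domain is a plot. An open subset $U$ of a Euclidean space carries the diffeology of all smooth maps into $U$. The $D$-topology on a diffeological space $X$ is the finest topology for which all plots are continuous. The free diffeological vector space $F(U)$ is the vector space $\bigoplus_{u\in U}\mathbb{R}$ with basis $\{[u]:u\in U\}$, whose plots are the maps locally of the form $w\mapsto\sum_{i=1}^n r_i(w)[q_i(w)]$ with $n\ge 0$, $r_i$ smooth real-valued functions and $q_i$ smooth maps into $U$. Equivalently (for $U\ne\emptyset$), its $D$-topology is the one in which $A\subseteq F(U)$ is open iff $\rho_n^{-1}(A)$ is open in $(\mathbb{R}\times U)^n$ for every $n\ge 1$, where $\rho_n(r_1,u_1,\ldots,r_n,u_n)=\sum_{i=1}^n r_i[u_i]$. A topological vector space is a vector space with a topology for which addition (from the product topology) and scalar multiplication are continuous. *)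

theory Defs
  imports "HOL-Analysis.Analysis" "HOL-Analysis.Finite_Function_Topology"
begin

section \<open>Smooth maps between open subsets of Euclidean spaces\<close>

text \<open>
  The dimension of a plot domain is quantified over, so \<open>\<real>\<^sup>n\<close> (including \<open>\<real>\<^sup>0\<close>) is
  rendered as \<^const>\<open>Euclidean_space\<close> \<open>n\<close>: sequences of reals vanishing at all
  indices \<open>\<ge> n\<close>. Functions on an open set \<open>W\<close> are total functions of which only the values
  on \<open>W\<close> matter.
\<close>

definition partial_deriv :: "nat \<Rightarrow> ((nat \<Rightarrow> real) \<Rightarrow> real) \<Rightarrow> (nat \<Rightarrow> real) \<Rightarrow> real" where
  "partial_deriv i f x = deriv (\<lambda>t. f (x(i := t))) (x i)"

primrec C_k_on :: "nat \<Rightarrow> nat \<Rightarrow> (nat \<Rightarrow> real) set \<Rightarrow> ((nat \<Rightarrow> real) \<Rightarrow> real) \<Rightarrow> bool" where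
  "C_k_on 0 n W f \<longleftrightarrow>
     continuous_map (subtopology (Euclidean_space n) W) euclideanreal f"
| "C_k_on (Suc k) n W f \<longleftrightarrow>
     continuous_map (subtopology (Euclidean_space n) W) euclideanreal f \<and>
     (\<forall>i<n. (\<forall>x\<in>W. (\<lambda>t. f (x(i := t))) differentiable at (x i)) \<and>
             C_k_on k n W (partial_deriv i f))"

definition smooth_fun :: "nat \<Rightarrow> (nat \<Rightarrow> real) set \<Rightarrow> ((nat \<Rightarrow> real) \<Rightarrow> real) \<Rightarrow> bool" where
  "smooth_fun n W f \<longleftrightarrow> (\<forall>k. C_k_on k n W f)"

definition smooth_map ::
  "nat \<Rightarrow> (nat \<Rightarrow> real) set \<Rightarrow> nat \<Rightarrow> (nat \<Rightarrow> real) set \<Rightarrow> ((nat \<Rightarrow> real) \<Rightarrow> nat \<Rightarrow> real) \<Rightarrow> bool"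
  where
  "smooth_map n W m V g \<longleftrightarrow>
     g ` W \<subseteq> V \<inter> topspace (Euclidean_space m) \<and> (\<forall>i<m. smooth_fun n W (\<lambda>w. g w i))"


subsection \<open>Chain rule and closure of smoothness under composition\<close>

lemma openin_Euclidean_space_box:
  assumes W: "openin (Euclidean_space n) W" and a: "a \<in> W"
  shows "\<exists>e>0. \<forall>y\<in>topspace (Euclidean_space n). (\<forall>i<n. \<bar>y i - a i\<bar> < e) \<longrightarrow> y \<in> W"
proof -
  obtain S where S: "openin (powertop_real UNIV) S" "W = S \<inter> {x. \<forall>i\<ge>n. x i = 0}"
    using W unfolding Euclidean_space_def openin_subtopology by blast
  then obtain B where B: "\<And>i. open (B i)" "a \<in> Pi\<^sub>E UNIV B" "Pi\<^sub>E UNIV B \<subseteq> S"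
    using a unfolding openin_product_topology_alt by fastforce
  have "\<exists>e>0. \<forall>t. \<bar>t - a i\<bar> < e \<longrightarrow> t \<in> B i" for i
    using B(1)[of i] B(2) unfolding open_dist by (force simp: dist_real_def PiE_iff)
  then obtain e where e: "\<And>i. e i > 0" "\<And>i t. \<bar>t - a i\<bar> < e i \<Longrightarrow> t \<in> B i"
    by metis
  define d where "d = Min (insert 1 (e ` {..<n}))"
  have d: "d > 0" "\<And>i. i < n \<Longrightarrow> d \<le> e i"
    using e(1) by (auto simp: d_def)
  show ?thesis
  proof (intro exI[of _ d] conjI ballI impI d(1))
    fix y assume y: "y \<in> topspace (Euclidean_space n)" "\<forall>i<n. \<bar>y i - a i\<bar> < d"
    have "y i \<in> B i" for i
    proof (cases "i < n")
      case True
      then show ?thesis using y(2) d(2) e(2) by force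
    next
      case False
      then have "y i = a i"
        using y(1) a S(2) by (auto simp: topspace_Euclidean_space)
      then show ?thesis using e(1)[of i] e(2)[of "y i" i] by simp
    qed
    then show "y \<in> W"
      using B(3) y(1) S(2) by (auto simp: topspace_Euclidean_space PiE_iff)
  qed
qed

lemma topspace_open_subtopology:
  "openin T W \<Longrightarrow> topspace (subtopology T W) = W"
  by (metis openin_subset topspace_subtopology_subset)

lemma continuous_map_box:
  assumes f: "continuous_map (subtopology (Euclidean_space n) W) euclideanreal f"
    and W: "openin (Euclidean_space n) W" and a: "a \<in> W" and "\<epsilon> > 0"
  shows "\<exists>e>0. \<forall>y\<in>topspace (Euclidean_space n). (\<forall>i<n. \<bar>y i - a i\<bar> < e) \<longrightarrow>
    y \<in> W \<and> \<bar>f y - f a\<bar> < \<epsilon>"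
proof -
  have "openin (subtopology (Euclidean_space n) W)
      {y \<in> topspace (subtopology (Euclidean_space n) W). f y \<in> ball (f a) \<epsilon>}"
    using f by (rule openin_continuous_map_preimage) simp
  then have "openin (Euclidean_space n) {y \<in> W. f y \<in> ball (f a) \<epsilon>}"
    unfolding topspace_open_subtopology[OF W] openin_open_subtopology[OF W] by blast
  moreover have "a \<in> {y \<in> W. f y \<in> ball (f a) \<epsilon>}"
    using a \<open>\<epsilon> > 0\<close> by simp
  ultimately have "\<exists>e>0. \<forall>y\<in>topspace (Euclidean_space n). (\<forall>i<n. \<bar>y i - a i\<bar> < e) \<longrightarrow>
      y \<in> {y \<in> W. f y \<in> ball (f a) \<epsilon>}"
    by (rule openin_Euclidean_space_box)
  then show ?thesis
    by (simp add: dist_real_def abs_minus_commute)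
qed

lemma partial_deriv_DERIV:
  assumes "(\<lambda>t. f (x(i := t))) differentiable at (x i)"
  shows "((\<lambda>t. f (x(i := t))) has_field_derivative partial_deriv i f x) (at (x i))"
  using assms unfolding partial_deriv_def by (simp add: DERIV_deriv_iff_real_differentiable)

lemma partial_mean_value:
  fixes z :: "nat \<Rightarrow> real"
  assumes diff: "\<And>s. min (z k) b \<le> s \<Longrightarrow> s \<le> max (z k) b \<Longrightarrow>
      (\<lambda>t. f ((z(k := s))(k := t))) differentiable at s"
    and "b \<noteq> z k"
  obtains s where "min (z k) b \<le> s" "s \<le> max (z k) b"
    "f (z(k := b)) - f z = partial_deriv k f (z(k := s)) * (b - z k)"
proof -
  have D: "((\<lambda>t. f (z(k := t))) has_field_derivative partial_deriv k f (z(k := s))) (at s)"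
    if "min (z k) b \<le> s" "s \<le> max (z k) b" for s
    using partial_deriv_DERIV[of f "z(k := s)" k] diff[OF that] by simp
  show ?thesis
  proof (cases "z k < b")
    case True
    obtain s where "z k < s" "s < b"
      "f (z(k := b)) - f (z(k := z k)) = (b - z k) * partial_deriv k f (z(k := s))"
      using MVT2[OF True, of "\<lambda>t. f (z(k := t))" "\<lambda>s. partial_deriv k f (z(k := s))"] D True
      by auto
    then show ?thesis
      by (intro that[of s]) auto
  next
    case False
    then have lt: "b < z k"
      using \<open>b \<noteq> z k\<close> by simp
    obtain s where "b < s" "s < z k"
      "f (z(k := z k)) - f (z(k := b)) = (z k - b) * partial_deriv k f (z(k := s))"
      using MVT2[OF lt, of "\<lambda>t. f (z(k := t))" "\<lambda>s. partial_deriv k f (z(k := s))"] D lt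
      by auto
    then show ?thesis
      by (intro that[of s]) (auto simp: algebra_simps)
  qed
qed

lemma chain_rule_partial:
  fixes \<gamma> :: "real \<Rightarrow> nat \<Rightarrow> real"
  assumes W: "openin (Euclidean_space l) W"
    and diff: "\<And>i x. i < l \<Longrightarrow> x \<in> W \<Longrightarrow> (\<lambda>t. f (x(i := t))) differentiable at (x i)"
    and cont: "\<And>i. i < l \<Longrightarrow>
      continuous_map (subtopology (Euclidean_space l) W) euclideanreal (partial_deriv i f)"
    and \<gamma>W: "\<forall>\<^sub>F t in nhds t0. \<gamma> t \<in> W"
    and d: "\<And>i. i < l \<Longrightarrow> ((\<lambda>t. \<gamma> t i) has_field_derivative d i) (at t0)"
  shows "((\<lambda>t. f (\<gamma> t)) has_field_derivative (\<Sum>i<l. partial_deriv i f (\<gamma> t0) * d i)) (at t0)"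
proof -
  define a where "a = \<gamma> t0"
  define z where "z k t = (\<lambda>i. if i < k then \<gamma> t i else a i)" for k t
  have a: "a \<in> W"
    using \<gamma>W eventually_nhds_x_imp_x unfolding a_def by blast
  have WE: "W \<subseteq> {x. \<forall>i\<ge>l. x i = 0}"
    using openin_subset[OF W] by (simp add: topspace_Euclidean_space)
  have step: "((\<lambda>t. f (z (Suc k) t) - f (z k t)) has_field_derivative partial_deriv k f a * d k) (at t0)"
    if k: "k < l" for k
  proof -
    define G where "G t = (if \<gamma> t k = a k then partial_deriv k f a
       else (f (z (Suc k) t) - f (z k t)) / (\<gamma> t k - a k))" for t
    have zSuc: "z (Suc k) t = (z k t)(k := \<gamma> t k)" for t
      by (auto simp: z_def fun_eq_iff less_Suc_eq)
    have zk: "z k t k = a k" for t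
      by (simp add: z_def)
    have G: "f (z (Suc k) t) - f (z k t) = G t * (\<gamma> t k - a k)" for t
    proof (cases "\<gamma> t k = a k")
      case True
      then have "z (Suc k) t = z k t"
        using zSuc zk by (metis fun_upd_triv)
      then show ?thesis using True by simp
    qed (simp add: G_def)
    have Glim: "(G \<longlongrightarrow> partial_deriv k f a) (at t0)"
    proof (rule tendstoI)
      fix \<epsilon> :: real assume "\<epsilon> > 0"
      obtain e where e: "e > 0"
        "\<forall>y\<in>topspace (Euclidean_space l). (\<forall>i<l. \<bar>y i - a i\<bar> < e) \<longrightarrow>
           y \<in> W \<and> \<bar>partial_deriv k f y - partial_deriv k f a\<bar> < \<epsilon>"
        using continuous_map_box[OF cont[OF k] W a \<open>\<epsilon> > 0\<close>] by blast
      have "\<forall>\<^sub>F t in at t0. \<forall>i<l. \<bar>\<gamma> t i - a i\<bar> < e"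
      proof -
        have "\<forall>\<^sub>F t in at t0. \<bar>\<gamma> t i - a i\<bar> < e" if "i < l" for i
        proof -
          have "isCont (\<lambda>t. \<gamma> t i) t0"
            using d[OF that] DERIV_isCont by blast
          then have "((\<lambda>t. \<gamma> t i) \<longlongrightarrow> a i) (at t0)"
            by (simp add: isCont_def a_def)
          from tendstoD[OF this e(1)] show ?thesis
            by (simp add: dist_real_def)
        qed
        then have "\<forall>\<^sub>F t in at t0. \<forall>i\<in>{..<l}. \<bar>\<gamma> t i - a i\<bar> < e"
          by (intro eventually_ball_finite) auto
        then show ?thesis by (rule eventually_mono) auto
      qed
      then show "\<forall>\<^sub>F t in at t0. dist (G t) (partial_deriv k f a) < \<epsilon>"
      proof (rule eventually_mono)
        fix t assume t: "\<forall>i<l. \<bar>\<gamma> t i - a i\<bar> < e"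
        show "dist (G t) (partial_deriv k f a) < \<epsilon>"
        proof (cases "\<gamma> t k = a k")
          case True
          then show ?thesis using \<open>\<epsilon> > 0\<close> by (simp add: G_def)
        next
          case False
          have box: "(z k t)(k := s) \<in> W \<and>
              \<bar>partial_deriv k f ((z k t)(k := s)) - partial_deriv k f a\<bar> < \<epsilon>"
            if "min (z k t k) (\<gamma> t k) \<le> s" "s \<le> max (z k t k) (\<gamma> t k)" for s
          proof (intro e(2)[rule_format])
            show "(z k t)(k := s) \<in> topspace (Euclidean_space l)"
              using a WE k by (auto simp: topspace_Euclidean_space z_def)
            fix i assume i: "i < l"
            have "\<bar>s - a k\<bar> < e"
              using that t[rule_format, OF k] e(1) unfolding zk by linarith
            then show "\<bar>((z k t)(k := s)) i - a i\<bar> < e"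
              using t i e(1) by (auto simp: z_def)
          qed
          obtain s where s: "min (z k t k) (\<gamma> t k) \<le> s" "s \<le> max (z k t k) (\<gamma> t k)"
            "f ((z k t)(k := \<gamma> t k)) - f (z k t) = partial_deriv k f ((z k t)(k := s)) * (\<gamma> t k - z k t k)"
          proof (rule partial_mean_value[of "z k t" k "\<gamma> t k" f])
            show "(\<lambda>ta. f ((z k t)(k := s, k := ta))) differentiable at s"
              if "min (z k t k) (\<gamma> t k) \<le> s" "s \<le> max (z k t k) (\<gamma> t k)" for s
              using diff[OF k conjunct1[OF box[OF that]]] by simp
          qed (use False zk in auto)
          then have "G t = partial_deriv k f ((z k t)(k := s))"
            using False by (simp add: G_def zSuc zk)
          then show ?thesis
            using box[OF s(1,2)] by (simp add: dist_real_def)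
        qed
      qed
    qed
    have "((\<lambda>t. (\<gamma> t k - a k) / (t - t0)) \<longlongrightarrow> d k) (at t0)"
      using d[OF k] by (simp add: has_field_derivative_iff a_def)
    with Glim have "((\<lambda>t. G t * ((\<gamma> t k - a k) / (t - t0))) \<longlongrightarrow> partial_deriv k f a * d k) (at t0)"
      by (rule tendsto_mult)
    moreover have "f (z (Suc k) t0) - f (z k t0) = 0"
      unfolding G by (simp add: a_def)
    ultimately show ?thesis
      unfolding has_field_derivative_iff G by (simp add: a_def)
  qed
  have "((\<lambda>t. f (z k t)) has_field_derivative (\<Sum>i<k. partial_deriv i f a * d i)) (at t0)"
    if "k \<le> l" for k
    using that
  proof (induction k)
    case 0
    then show ?case by (simp add: z_def)
  next
    case (Suc k)
    then have "((\<lambda>t. f (z k t) + (f (z (Suc k) t) - f (z k t))) has_field_derivative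
        (\<Sum>i<k. partial_deriv i f a * d i) + partial_deriv k f a * d k) (at t0)"
      using step by (intro DERIV_add) auto
    then show ?case by simp
  qed
  from this[OF order_refl]
  have "((\<lambda>t. f (z l t)) has_field_derivative (\<Sum>i<l. partial_deriv i f a * d i)) (at t0)" .
  moreover have ev: "\<forall>\<^sub>F t in nhds t0. f (z l t) = f (\<gamma> t)"
    using \<gamma>W
  proof (rule eventually_mono)
    fix t assume "\<gamma> t \<in> W"
    then have "\<gamma> t \<in> {x. \<forall>i\<ge>l. x i = 0}" "a \<in> {x. \<forall>i\<ge>l. x i = 0}"
      using a WE by blast+
    then have "\<forall>i\<ge>l. \<gamma> t i = a i"
      by simp
    then have "z l t = \<gamma> t"
      by (auto simp: z_def fun_eq_iff)
    then show "f (z l t) = f (\<gamma> t)" by simp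
  qed
  ultimately show ?thesis
    unfolding a_def using DERIV_cong_ev[OF refl ev refl] by blast
qed

lemma continuous_map_cong_on:
  assumes "continuous_map (subtopology T W) S f" "\<And>x. x \<in> W \<Longrightarrow> f x = g x"
  shows "continuous_map (subtopology T W) S g"
  using assms by (subst continuous_map_eq) (auto intro: continuous_map_eq)

lemma eventually_line_in_open:
  assumes "openin (Euclidean_space n) W" "x \<in> W" "i < n"
  shows "\<forall>\<^sub>F t in nhds (x i). x(i := t) \<in> W"
proof -
  obtain e where e: "e > 0"
    "\<forall>y\<in>topspace (Euclidean_space n). (\<forall>j<n. \<bar>y j - x j\<bar> < e) \<longrightarrow> y \<in> W"
    using openin_Euclidean_space_box[OF assms(1,2)] by blast
  have x: "x \<in> topspace (Euclidean_space n)"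
    using assms openin_subset by blast
  show ?thesis
    unfolding eventually_nhds_metric
  proof (intro exI[of _ e] conjI e(1) allI impI e(2)[rule_format])
    fix t assume "dist t (x i) < e"
    then show "\<bar>(x(i := t)) j - x j\<bar> < e" for j
      using e(1) by (auto simp: dist_real_def)
    show "x(i := t) \<in> topspace (Euclidean_space n)"
      using x assms(3) by (auto simp: topspace_Euclidean_space)
  qed
qed

lemma partial_deriv_cong:
  assumes "openin (Euclidean_space n) W" "x \<in> W" "i < n" "\<And>x. x \<in> W \<Longrightarrow> f x = g x"
  shows "partial_deriv i f x = partial_deriv i g x"
    and "(\<lambda>t. f (x(i := t))) differentiable at (x i) \<Longrightarrow>
         (\<lambda>t. g (x(i := t))) differentiable at (x i)"
proof -
  have ev: "\<forall>\<^sub>F t in nhds (x i). f (x(i := t)) = g (x(i := t))"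
    using eventually_line_in_open[OF assms(1-3)] by (rule eventually_mono) (use assms(4) in auto)
  then show "partial_deriv i f x = partial_deriv i g x"
    unfolding partial_deriv_def by (intro deriv_cong_ev) auto
  assume "(\<lambda>t. f (x(i := t))) differentiable at (x i)"
  then show "(\<lambda>t. g (x(i := t))) differentiable at (x i)"
    using DERIV_cong_ev[OF refl ev refl] unfolding real_differentiable_def by blast
qed

lemma C_k_on_cong:
  assumes "openin (Euclidean_space n) W" "\<And>x. x \<in> W \<Longrightarrow> f x = g x" "C_k_on k n W f"
  shows "C_k_on k n W g"
  using assms(2,3)
proof (induction k arbitrary: f g)
  case 0
  then show ?case using continuous_map_cong_on[of _ W _ f g] by auto
next
  case (Suc k)
  have "C_k_on k n W (partial_deriv i g)" if i: "i < n" for i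
    by (rule Suc.IH[of "partial_deriv i f"])
      (use Suc.prems i in \<open>auto intro: partial_deriv_cong(1)[OF assms(1)]\<close>)
  moreover have "(\<lambda>t. g (x(i := t))) differentiable at (x i)" if "i < n" "x \<in> W" for i x
  proof (rule partial_deriv_cong(2)[of n W x i f g])
    show "(\<lambda>t. f (x(i := t))) differentiable at (x i)"
      using Suc.prems(2) that unfolding C_k_on.simps by blast
  qed (use assms(1) that Suc.prems(1) in blast)+
  ultimately show ?case
    using Suc.prems continuous_map_cong_on[of _ W _ f g] by auto
qed

lemma C_k_on_continuous:
  "C_k_on k n W f \<Longrightarrow> continuous_map (subtopology (Euclidean_space n) W) euclideanreal f"
  by (cases k) auto

lemma C_k_on_SucD: "C_k_on (Suc k) n W f \<Longrightarrow> C_k_on k n W f"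
  by (induction k arbitrary: f) auto

lemma C_k_on_subset: "C_k_on k n W f \<Longrightarrow> V \<subseteq> W \<Longrightarrow> C_k_on k n V f"
proof (induction k arbitrary: f)
  case 0
  then show ?case by (auto intro: continuous_map_from_subtopology_mono)
next
  case (Suc k)
  then show ?case by (auto intro: continuous_map_from_subtopology_mono)
qed

lemma partial_deriv_const [simp]: "partial_deriv i (\<lambda>_. c) = (\<lambda>_. 0)"
  by (auto simp: partial_deriv_def fun_eq_iff)

lemma C_k_on_const: "C_k_on k n W (\<lambda>_. c)"
  by (induction k arbitrary: c) auto

lemma C_k_on_add:
  assumes "openin (Euclidean_space n) W" "C_k_on k n W f" "C_k_on k n W g"
  shows "C_k_on k n W (\<lambda>x. f x + g x)"
  using assms(2,3)
proof (induction k arbitrary: f g)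
  case 0
  then show ?case by (auto intro: continuous_map_add)
next
  case (Suc k)
  have D: "((\<lambda>t. f (x(i := t)) + g (x(i := t))) has_field_derivative
      (partial_deriv i f x + partial_deriv i g x)) (at (x i))" if "i < n" "x \<in> W" for i x
    using Suc.prems that by (intro DERIV_add partial_deriv_DERIV) auto
  have "C_k_on k n W (partial_deriv i (\<lambda>x. f x + g x))" if i: "i < n" for i
  proof (rule C_k_on_cong[OF assms(1)])
    show "C_k_on k n W (\<lambda>x. partial_deriv i f x + partial_deriv i g x)"
      using Suc i by auto
    show "partial_deriv i f x + partial_deriv i g x = partial_deriv i (\<lambda>x. f x + g x) x"
      if "x \<in> W" for x
      using DERIV_imp_deriv[OF D[OF i that]] by (simp add: partial_deriv_def)
  qed
  then show ?case
    using Suc.prems D by (auto intro!: continuous_map_add simp: real_differentiable_def)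
qed

lemma C_k_on_mult:
  assumes "openin (Euclidean_space n) W" "C_k_on k n W f" "C_k_on k n W g"
  shows "C_k_on k n W (\<lambda>x. f x * g x)"
  using assms(2,3)
proof (induction k arbitrary: f g)
  case 0
  then show ?case by (auto intro: continuous_map_real_mult)
next
  case (Suc k)
  have D: "((\<lambda>t. f (x(i := t)) * g (x(i := t))) has_field_derivative
      (partial_deriv i f x * g x + partial_deriv i g x * f x)) (at (x i))"
    if "i < n" "x \<in> W" for i x
  proof -
    have "((\<lambda>t. f (x(i := t)) * g (x(i := t))) has_field_derivative
      (partial_deriv i f x * g (x(i := x i)) + partial_deriv i g x * f (x(i := x i)))) (at (x i))"
      using Suc.prems that by (intro DERIV_mult partial_deriv_DERIV) auto
    then show ?thesis by simp
  qed
  have "C_k_on k n W (partial_deriv i (\<lambda>x. f x * g x))" if i: "i < n" for i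
  proof (rule C_k_on_cong[OF assms(1)])
    show "C_k_on k n W (\<lambda>x. partial_deriv i f x * g x + partial_deriv i g x * f x)"
      by (intro C_k_on_add[OF assms(1)] Suc.IH) (use Suc.prems i C_k_on_SucD in auto)
    show "partial_deriv i f x * g x + partial_deriv i g x * f x = partial_deriv i (\<lambda>x. f x * g x) x"
      if "x \<in> W" for x
      using DERIV_imp_deriv[OF D[OF i that]] by (simp add: partial_deriv_def)
  qed
  then show ?case
    using Suc.prems D by (auto intro!: continuous_map_real_mult simp: real_differentiable_def)
qed

lemma C_k_on_sum:
  assumes "openin (Euclidean_space n) W" "\<And>i. i < l \<Longrightarrow> C_k_on k n W (f i)"
  shows "C_k_on k n W (\<lambda>x. \<Sum>i<(l::nat). f i x)"
  using assms(2)
proof (induction l)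
  case 0
  then show ?case by (simp add: C_k_on_const)
next
  case (Suc l)
  then show ?case by (simp add: C_k_on_add[OF assms(1)])
qed

lemma continuous_map_smooth_map:
  assumes "smooth_map n W m V g"
  shows "continuous_map (subtopology (Euclidean_space n) W) (subtopology (Euclidean_space m) V) g"
proof -
  have "continuous_map (subtopology (Euclidean_space n) W) euclideanreal (\<lambda>w. g w i)" for i
  proof (cases "i < m")
    case True
    then show ?thesis
      using assms C_k_on_continuous by (auto simp: smooth_map_def smooth_fun_def)
  next
    case False
    show ?thesis
      by (rule continuous_map_cong_on[of _ _ _ "\<lambda>_. 0"])
        (use assms False in \<open>auto simp: smooth_map_def topspace_Euclidean_space\<close>)
  qed
  then have "continuous_map (subtopology (Euclidean_space n) W) (powertop_real UNIV) g"
    by (simp add: continuous_map_componentwise_UNIV)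
  moreover have "g ` W \<subseteq> V \<inter> {x. \<forall>i\<ge>m. x i = 0}"
    using assms by (simp add: smooth_map_def topspace_Euclidean_space)
  ultimately show ?thesis
    unfolding Euclidean_space_def subtopology_subtopology
    by (auto simp: continuous_map_in_subtopology)
qed

lemma C_k_on_compose:
  assumes W: "openin (Euclidean_space n) W" and V: "openin (Euclidean_space m) V"
    and g: "smooth_map n W m V g"
  shows "C_k_on k m V f \<Longrightarrow> C_k_on k n W (\<lambda>w. f (g w))"
proof (induction k arbitrary: f)
  case 0
  then show ?case
    using continuous_map_compose[OF continuous_map_smooth_map[OF g], of euclideanreal f]
    unfolding o_def C_k_on.simps by blast
next
  case (Suc k)
  have gk: "C_k_on k n W (\<lambda>w. g w i)" if "i < m" for i k
    using g that by (simp add: smooth_map_def smooth_fun_def)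
  have D: "((\<lambda>t. f (g (x(j := t)))) has_field_derivative
      (\<Sum>i<m. partial_deriv i f (g x) * partial_deriv j (\<lambda>w. g w i) x)) (at (x j))"
    if "j < n" "x \<in> W" for j x
  proof -
    have "((\<lambda>t. f (g (x(j := t)))) has_field_derivative
      (\<Sum>i<m. partial_deriv i f (g (x(j := x j))) * partial_deriv j (\<lambda>w. g w i) x)) (at (x j))"
    proof (rule chain_rule_partial[OF V])
      show "(\<lambda>t. f (x(i := t))) differentiable at (x i)" if "i < m" "x \<in> V" for i x
        using Suc.prems that by simp
      show "continuous_map (subtopology (Euclidean_space m) V) euclideanreal (partial_deriv i f)"
        if "i < m" for i
        using Suc.prems that by (auto intro: C_k_on_continuous)
      show "\<forall>\<^sub>F t in nhds (x j). g (x(j := t)) \<in> V"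
        using eventually_line_in_open[OF W \<open>x \<in> W\<close> \<open>j < n\<close>]
        by (rule eventually_mono) (use g in \<open>auto simp: smooth_map_def\<close>)
      show "((\<lambda>t. g (x(j := t)) i) has_field_derivative partial_deriv j (\<lambda>w. g w i) x) (at (x j))"
        if "i < m" for i
        using gk[OF that, of "Suc 0"] \<open>x \<in> W\<close> \<open>j < n\<close>
        by (intro partial_deriv_DERIV[of "\<lambda>w. g w i"]) auto
    qed
    then show ?thesis by simp
  qed
  have "C_k_on k n W (partial_deriv j (\<lambda>w. f (g w)))" if j: "j < n" for j
  proof (rule C_k_on_cong[OF W])
    show "C_k_on k n W (\<lambda>x. \<Sum>i<m. partial_deriv i f (g x) * partial_deriv j (\<lambda>w. g w i) x)"
      by (intro C_k_on_sum C_k_on_mult W Suc.IH)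
        (use Suc.prems gk[of _ "Suc k"] j in auto)
    show "(\<Sum>i<m. partial_deriv i f (g x) * partial_deriv j (\<lambda>w. g w i) x) =
        partial_deriv j (\<lambda>w. f (g w)) x" if "x \<in> W" for x
      using DERIV_imp_deriv[OF D[OF j that]] by (simp add: partial_deriv_def)
  qed
  moreover have "continuous_map (subtopology (Euclidean_space n) W) euclideanreal (\<lambda>w. f (g w))"
    using continuous_map_compose[OF continuous_map_smooth_map[OF g], of euclideanreal f]
      C_k_on_continuous[OF Suc.prems] unfolding o_def by blast
  moreover have "(\<lambda>t. f (g (x(j := t)))) differentiable at (x j)" if "j < n" "x \<in> W" for j x
    unfolding real_differentiable_def by (rule exI, rule D[OF that])
  ultimately show ?case
    unfolding C_k_on.simps by blast
qed

lemma smooth_fun_compose: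
  assumes "openin (Euclidean_space n) W" "openin (Euclidean_space m) V"
    "smooth_map n W m V g" "smooth_fun m V f"
  shows "smooth_fun n W (\<lambda>w. f (g w))"
  using assms C_k_on_compose by (auto simp: smooth_fun_def)

lemma smooth_map_compose:
  assumes "openin (Euclidean_space n) W" "openin (Euclidean_space m) V"
    "smooth_map n W m V g" "smooth_map m V l U f"
  shows "smooth_map n W l U (\<lambda>w. f (g w))"
  unfolding smooth_map_def
proof (intro conjI allI impI)
  show "(\<lambda>w. f (g w)) ` W \<subseteq> U \<inter> topspace (Euclidean_space l)"
    using assms(3,4) unfolding smooth_map_def by blast
  show "smooth_fun n W (\<lambda>w. f (g w) i)" if "i < l" for i
    using smooth_fun_compose[OF assms(1-3), of "\<lambda>v. f v i"] assms(4) that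
    by (simp add: smooth_map_def)
qed

lemma smooth_map_subset:
  assumes "smooth_map n W m V g" "W' \<subseteq> W" "g ` W' \<subseteq> V'"
  shows "smooth_map n W' m V' g"
  unfolding smooth_map_def smooth_fun_def
proof (intro conjI allI impI)
  show "g ` W' \<subseteq> V' \<inter> topspace (Euclidean_space m)"
    using assms unfolding smooth_map_def by blast
  show "C_k_on k n W' (\<lambda>w. g w i)" if "i < m" for i k
    using assms(1) that by (intro C_k_on_subset[OF _ assms(2)]) (simp add: smooth_map_def smooth_fun_def)
qed


section \<open>Diffeological spaces and the D-topology\<close>

text \<open>
  \<open>plot n W p\<close> means that \<open>W\<close> is an open subset of \<open>\<real>\<^sup>n\<close> and that the restriction of \<open>p\<close> to
  \<open>W\<close> is a plot; \<open>plot_cong\<close> says that this depends on that restriction only.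
\<close>

locale diffeological_space =
  fixes X :: "'a set"
    and plot :: "nat \<Rightarrow> (nat \<Rightarrow> real) set \<Rightarrow> ((nat \<Rightarrow> real) \<Rightarrow> 'a) \<Rightarrow> bool"
  assumes plot_domain: "plot n W p \<Longrightarrow> openin (Euclidean_space n) W"
    and plot_range: "plot n W p \<Longrightarrow> p ` W \<subseteq> X"
    and plot_cong: "plot n W p \<Longrightarrow> (\<And>w. w \<in> W \<Longrightarrow> q w = p w) \<Longrightarrow> plot n W q"
    and plot_const: "openin (Euclidean_space n) W \<Longrightarrow> x \<in> X \<Longrightarrow> plot n W (\<lambda>_. x)"
    and plot_compose:
      "plot n W p \<Longrightarrow> openin (Euclidean_space m) V \<Longrightarrow> smooth_map m V n W g \<Longrightarrow> plot m V (p \<circ> g)"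
    and plot_local: "(\<And>V. V \<in> \<V> \<Longrightarrow> plot n V p) \<Longrightarrow> plot n (\<Union>\<V>) p"

definition plots_continuous ::
  "'a set \<Rightarrow> (nat \<Rightarrow> (nat \<Rightarrow> real) set \<Rightarrow> ((nat \<Rightarrow> real) \<Rightarrow> 'a) \<Rightarrow> bool) \<Rightarrow> 'a topology \<Rightarrow> bool"
  where
  "plots_continuous X plot T \<longleftrightarrow>
     topspace T = X \<and>
     (\<forall>n W p. plot n W p \<longrightarrow> continuous_map (subtopology (Euclidean_space n) W) T p)"

definition D_topology ::
  "'a set \<Rightarrow> (nat \<Rightarrow> (nat \<Rightarrow> real) set \<Rightarrow> ((nat \<Rightarrow> real) \<Rightarrow> 'a) \<Rightarrow> bool) \<Rightarrow> 'a topology"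
  where
  "D_topology X plot =
     (THE T. plots_continuous X plot T \<and>
             (\<forall>T'. plots_continuous X plot T' \<longrightarrow> (\<forall>A. openin T' A \<longrightarrow> openin T A)))"

context diffeological_space
begin

definition D_open :: "'a set \<Rightarrow> bool" where
  "D_open A \<longleftrightarrow> A \<subseteq> X \<and>
     (\<forall>n W p. plot n W p \<longrightarrow> openin (Euclidean_space n) {w \<in> W. p w \<in> A})"

lemma openin_topology_D_open: "openin (topology D_open) = D_open"
proof -
  have "istopology D_open"
    unfolding istopology_def
  proof (intro conjI allI impI)
    fix A B assume AB: "D_open A" "D_open B"
    have eq: "{w \<in> W. p w \<in> A \<inter> B} = {w \<in> W. p w \<in> A} \<inter> {w \<in> W. p w \<in> B}"
      for W and p :: "(nat \<Rightarrow> real) \<Rightarrow> 'a"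
      by auto
    show "D_open (A \<inter> B)"
      unfolding D_open_def eq using AB by (auto simp: D_open_def intro!: openin_Int)
  next
    fix \<K> assume \<K>: "\<forall>K\<in>\<K>. D_open K"
    have eq: "{w \<in> W. p w \<in> \<Union>\<K>} = (\<Union>K\<in>\<K>. {w \<in> W. p w \<in> K})"
      for W and p :: "(nat \<Rightarrow> real) \<Rightarrow> 'a"
      by auto
    show "D_open (\<Union>\<K>)"
      unfolding D_open_def eq using \<K> by (auto simp: D_open_def intro!: openin_Union)
  qed
  then show ?thesis
    by simp
qed

lemma topspace_topology_D_open: "topspace (topology D_open) = X"
proof -
  have "{w \<in> W. p w \<in> X} = W" if "plot n W p" for n W p
    using plot_range[OF that] by auto
  then have "D_open X"
    by (auto simp: D_open_def dest: plot_domain)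
  then show ?thesis
    unfolding topspace_def openin_topology_D_open by (auto simp: D_open_def)
qed

lemma topspace_plot_domain:
  "plot n W p \<Longrightarrow> topspace (subtopology (Euclidean_space n) W) = W"
  by (metis openin_subset plot_domain topspace_subtopology_subset)

lemma plots_continuous_topology_D_open: "plots_continuous X plot (topology D_open)"
  unfolding plots_continuous_def
proof (intro conjI allI impI topspace_topology_D_open)
  fix n W p assume p: "plot n W p"
  show "continuous_map (subtopology (Euclidean_space n) W) (topology D_open) p"
    unfolding continuous_map_def topspace_plot_domain[OF p] topspace_topology_D_open
      openin_topology_D_open openin_open_subtopology[OF plot_domain[OF p]]
    using plot_range[OF p] p unfolding D_open_def by blast
qed

lemma D_open_finest:
  assumes "plots_continuous X plot T" and "openin T A"
  shows "D_open A"
  unfolding D_open_def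
proof (intro conjI allI impI)
  show "A \<subseteq> X"
    using assms openin_subset by (auto simp: plots_continuous_def)
next
  fix n W p assume p: "plot n W p"
  then have "continuous_map (subtopology (Euclidean_space n) W) T p"
    using assms(1) unfolding plots_continuous_def by blast
  from openin_continuous_map_preimage[OF this assms(2)]
  have "openin (subtopology (Euclidean_space n) W) {w \<in> W. p w \<in> A}"
    unfolding topspace_plot_domain[OF p] .
  then show "openin (Euclidean_space n) {w \<in> W. p w \<in> A}"
    unfolding openin_open_subtopology[OF plot_domain[OF p]] by blast
qed

lemma D_topology_eq: "D_topology X plot = topology D_open"
  unfolding D_topology_def
proof (rule the_equality)
  show "plots_continuous X plot (topology D_open) \<and>
     (\<forall>T'. plots_continuous X plot T' \<longrightarrow> (\<forall>A. openin T' A \<longrightarrow> openin (topology D_open) A))"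
    using plots_continuous_topology_D_open D_open_finest openin_topology_D_open by simp
next
  fix T
  assume T: "plots_continuous X plot T \<and>
     (\<forall>T'. plots_continuous X plot T' \<longrightarrow> (\<forall>A. openin T' A \<longrightarrow> openin T A))"
  have "openin T A \<longleftrightarrow> D_open A" for A
    using T D_open_finest plots_continuous_topology_D_open openin_topology_D_open by metis
  then show "T = topology D_open"
    by (simp add: topology_eq openin_topology_D_open)
qed

lemma openin_D_topology:
  "openin (D_topology X plot) A \<longleftrightarrow>
     A \<subseteq> X \<and> (\<forall>n W p. plot n W p \<longrightarrow> openin (Euclidean_space n) {w \<in> W. p w \<in> A})"
  by (simp add: D_topology_eq openin_topology_D_open D_open_def)

lemma topspace_D_topology: "topspace (D_topology X plot) = X"
  by (simp add: D_topology_eq topspace_topology_D_open)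

end


section \<open>Topological vector spaces and the free diffeological vector space\<close>

text \<open>
  The vector space carried by \<open>T\<close> is a linear subspace of the ambient type, with the
  operations of that type; the topology of \<open>T\<close> is unrelated to any topology of the type class.
\<close>

definition topological_vector_space :: "'v::real_vector topology \<Rightarrow> bool" where
  "topological_vector_space T \<longleftrightarrow>
     subspace (topspace T) \<and>
     continuous_map (prod_topology T T) T (\<lambda>(x, y). x + y) \<and>
     continuous_map (prod_topology euclideanreal T) T (\<lambda>(c, x). c *\<^sub>R x)"

definition free_vector_space :: "'b set \<Rightarrow> ('b \<Rightarrow>\<^sub>0 real) set" where
  "free_vector_space U = {x. Poly_Mapping.keys x \<subseteq> U}"

abbreviation basis_vector :: "'b \<Rightarrow> ('b \<Rightarrow>\<^sub>0 real)" where
  "basis_vector u \<equiv> Poly_Mapping.single u 1"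

definition free_plot ::
  "nat \<Rightarrow> (nat \<Rightarrow> real) set \<Rightarrow> nat \<Rightarrow> (nat \<Rightarrow> real) set \<Rightarrow>
     ((nat \<Rightarrow> real) \<Rightarrow> ((nat \<Rightarrow> real) \<Rightarrow>\<^sub>0 real)) \<Rightarrow> bool" where
  "free_plot m U n W p \<longleftrightarrow>
     openin (Euclidean_space n) W \<and>
     (\<forall>w\<in>W. \<exists>V. openin (Euclidean_space n) V \<and> w \<in> V \<and> V \<subseteq> W \<and>
        (\<exists>(N::nat) r q. (\<forall>i<N. smooth_fun n V (r i)) \<and> (\<forall>i<N. smooth_map n V m U (q i)) \<and>
                 (\<forall>v\<in>V. p v = (\<Sum>i<N. r i v *\<^sub>R basis_vector (q i v)))))"


subsection \<open>The free plots form a diffeology\<close>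

lemma lookup_scaleR_real:
  fixes x :: "'b \<Rightarrow>\<^sub>0 real"
  shows "Poly_Mapping.lookup (c *\<^sub>R x) u = c * Poly_Mapping.lookup x u"
proof -
  have "finite {i. c *\<^sub>R Poly_Mapping.lookup x i \<noteq> 0}"
    by (rule finite_subset[OF _ finite_lookup[of x]]) auto
  then show ?thesis
    by (simp add: scaleR_poly_mapping_def Abs_poly_mapping_inverse)
qed

lemma free_plotE:
  assumes "free_plot m U n W p" "w \<in> W"
  obtains V and N :: nat and r q where "openin (Euclidean_space n) V" "w \<in> V" "V \<subseteq> W"
    "\<forall>i<N. smooth_fun n V (r i)" "\<forall>i<N. smooth_map n V m U (q i)"
    "\<forall>v\<in>V. p v = (\<Sum>i<N. r i v *\<^sub>R basis_vector (q i v))"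
proof -
  from assms have "\<exists>V. openin (Euclidean_space n) V \<and> w \<in> V \<and> V \<subseteq> W \<and>
      (\<exists>(N::nat) r q. (\<forall>i<N. smooth_fun n V (r i)) \<and> (\<forall>i<N. smooth_map n V m U (q i)) \<and>
               (\<forall>v\<in>V. p v = (\<Sum>i<N. r i v *\<^sub>R basis_vector (q i v))))"
    unfolding free_plot_def by (elim conjE) (drule (1) bspec)
  then show thesis
    by (elim exE conjE) (rule that)
qed

lemma free_plotI:
  assumes "openin (Euclidean_space n) W"
    and "\<And>w. w \<in> W \<Longrightarrow> \<exists>V (N::nat) r q. openin (Euclidean_space n) V \<and> w \<in> V \<and> V \<subseteq> W \<and>
      (\<forall>i<N. smooth_fun n V (r i)) \<and> (\<forall>i<N. smooth_map n V m U (q i)) \<and>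
      (\<forall>v\<in>V. p v = (\<Sum>i<N. r i v *\<^sub>R basis_vector (q i v)))"
  shows "free_plot m U n W p"
  using assms unfolding free_plot_def by simp

lemma diffeological_space_free:
  assumes U: "U \<subseteq> topspace (Euclidean_space m)"
  shows "diffeological_space (free_vector_space U) (free_plot m U)"
proof
  fix n W p assume p: "free_plot m U n W p"
  then show "openin (Euclidean_space n) W"
    by (simp add: free_plot_def)
  show "p ` W \<subseteq> free_vector_space U"
  proof clarify
    fix w assume w: "w \<in> W"
    obtain V and N :: nat and r q where V: "w \<in> V"
      and q: "\<forall>i<N. smooth_map n V m U (q i)"
      and eq: "\<forall>v\<in>V. p v = (\<Sum>i<N. r i v *\<^sub>R basis_vector (q i v))"
      using p w by (rule free_plotE)
    have "Poly_Mapping.keys (r i w *\<^sub>R basis_vector (q i w)) \<subseteq> U" if "i < N" for i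
    proof -
      have "q i w \<in> U"
        using q V that unfolding smooth_map_def by blast
      then show ?thesis
        by (auto simp: in_keys_iff lookup_scaleR_real lookup_single when_def split: if_splits)
    qed
    then have "Poly_Mapping.keys (\<Sum>i<N. r i w *\<^sub>R basis_vector (q i w)) \<subseteq> U"
      using keys_sum[of "\<lambda>i. r i w *\<^sub>R basis_vector (q i w)" "{..<N}"] by fastforce
    then show "p w \<in> free_vector_space U"
      using eq V by (simp add: free_vector_space_def)
  qed
  show "free_plot m U n W p'" if p': "\<And>w. w \<in> W \<Longrightarrow> p' w = p w" for p'
  proof (rule free_plotI)
    fix w assume "w \<in> W"
    with p obtain V and N :: nat and r q where V: "openin (Euclidean_space n) V" "w \<in> V" "V \<subseteq> W"
      "\<forall>i<N. smooth_fun n V (r i)" "\<forall>i<N. smooth_map n V m U (q i)"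
      and eq: "\<forall>v\<in>V. p v = (\<Sum>i<N. r i v *\<^sub>R basis_vector (q i v))"
      by (rule free_plotE)
    have "\<forall>v\<in>V. p' v = (\<Sum>i<N. r i v *\<^sub>R basis_vector (q i v))"
      using eq V(3) p' by (simp add: subset_iff)
    with V show "\<exists>V (N::nat) r q. openin (Euclidean_space n) V \<and> w \<in> V \<and> V \<subseteq> W \<and>
      (\<forall>i<N. smooth_fun n V (r i)) \<and> (\<forall>i<N. smooth_map n V m U (q i)) \<and>
      (\<forall>v\<in>V. p' v = (\<Sum>i<N. r i v *\<^sub>R basis_vector (q i v)))"
      by (intro exI conjI)
  qed (use p in \<open>simp add: free_plot_def\<close>)
  show "free_plot m U k V (p \<circ> g)"
    if V: "openin (Euclidean_space k) V" and g: "smooth_map k V n W g" for k V g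
  proof (rule free_plotI[OF V])
    fix v assume v: "v \<in> V"
    then have "g v \<in> W"
      using g unfolding smooth_map_def by blast
    with p obtain W' and N :: nat and r q where W': "openin (Euclidean_space n) W'" "g v \<in> W'" "W' \<subseteq> W"
      and r: "\<forall>i<N. smooth_fun n W' (r i)" and q: "\<forall>i<N. smooth_map n W' m U (q i)"
      and eq: "\<forall>v\<in>W'. p v = (\<Sum>i<N. r i v *\<^sub>R basis_vector (q i v))"
      by (rule free_plotE)
    define V' where "V' = {x \<in> V. g x \<in> W'}"
    have "openin (Euclidean_space n) W"
      using p by (simp add: free_plot_def)
    then have "openin (subtopology (Euclidean_space n) W) W'"
      using W' by (simp add: openin_open_subtopology)
    from openin_continuous_map_preimage[OF continuous_map_smooth_map[OF g] this]
    have V': "openin (Euclidean_space k) V'"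
      unfolding topspace_open_subtopology[OF V] openin_open_subtopology[OF V] V'_def by blast
    have g': "smooth_map k V' n W' g"
      by (rule smooth_map_subset[OF g]) (auto simp: V'_def)
    show "\<exists>V' (N::nat) r q. openin (Euclidean_space k) V' \<and> v \<in> V' \<and> V' \<subseteq> V \<and>
      (\<forall>i<N. smooth_fun k V' (r i)) \<and> (\<forall>i<N. smooth_map k V' m U (q i)) \<and>
      (\<forall>v\<in>V'. (p \<circ> g) v = (\<Sum>i<N. r i v *\<^sub>R basis_vector (q i v)))"
    proof (intro exI conjI)
      show "\<forall>i<N. smooth_fun k V' (\<lambda>w. r i (g w))"
        using r smooth_fun_compose[OF V' W'(1) g'] by blast
      show "\<forall>i<N. smooth_map k V' m U (\<lambda>w. q i (g w))"
        using q smooth_map_compose[OF V' W'(1) g'] by blast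
      show "\<forall>v\<in>V'. (p \<circ> g) v = (\<Sum>i<N. r i (g v) *\<^sub>R basis_vector (q i (g v)))"
        using eq by (simp add: V'_def)
      show "v \<in> V'" "V' \<subseteq> V"
        using v W'(2) by (auto simp: V'_def)
    qed (rule V')
  qed
next
  fix n W and x :: "(nat \<Rightarrow> real) \<Rightarrow>\<^sub>0 real"
  assume W: "openin (Euclidean_space n) W" and x: "x \<in> free_vector_space U"
  obtain h where h: "bij_betw h {..<card (Poly_Mapping.keys x)} (Poly_Mapping.keys x)"
    using ex_bij_betw_nat_finite[of "Poly_Mapping.keys x"] by (auto simp: atLeast0LessThan)
  have "x = (\<Sum>u\<in>Poly_Mapping.keys x. Poly_Mapping.lookup x u *\<^sub>R basis_vector u)"
    by (rule poly_mapping_eqI)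
      (auto simp: lookup_sum lookup_single when_def in_keys_iff lookup_scaleR_real
        sum.If_cases if_distrib cong: if_cong)
  also have "\<dots> = (\<Sum>i<card (Poly_Mapping.keys x). Poly_Mapping.lookup x (h i) *\<^sub>R basis_vector (h i))"
    by (rule sum.reindex_bij_betw[OF h, symmetric])
  finally have eq: "x = \<dots>" .
  have hU: "h i \<in> U" if "i < card (Poly_Mapping.keys x)" for i
    using h x that by (auto simp: free_vector_space_def bij_betw_def)
  show "free_plot m U n W (\<lambda>_. x)"
    unfolding free_plot_def
  proof (intro conjI ballI W exI)
    show "\<forall>i<card (Poly_Mapping.keys x). smooth_fun n W (\<lambda>_. Poly_Mapping.lookup x (h i))"
      by (simp add: smooth_fun_def C_k_on_const)
    show "\<forall>i<card (Poly_Mapping.keys x). smooth_map n W m U (\<lambda>_. h i)"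
      using hU U by (auto simp: smooth_map_def smooth_fun_def C_k_on_const)
    show "x = (\<Sum>i<card (Poly_Mapping.keys x). Poly_Mapping.lookup x (h i) *\<^sub>R basis_vector (h i))"
      by (rule eq)
  qed (use W in auto)
next
  fix \<V> n p assume \<V>: "\<And>V. V \<in> \<V> \<Longrightarrow> free_plot m U n V p"
  show "free_plot m U n (\<Union>\<V>) p"
  proof (rule free_plotI)
    show "openin (Euclidean_space n) (\<Union>\<V>)"
      using \<V> by (intro openin_Union) (simp add: free_plot_def)
    fix w assume "w \<in> \<Union>\<V>"
    then obtain W where W: "W \<in> \<V>" "w \<in> W"
      by blast
    obtain V and N :: nat and r q where V: "openin (Euclidean_space n) V" "w \<in> V" "V \<subseteq> W"
      "\<forall>i<N. smooth_fun n V (r i)" "\<forall>i<N. smooth_map n V m U (q i)"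
      "\<forall>v\<in>V. p v = (\<Sum>i<N. r i v *\<^sub>R basis_vector (q i v))"
      using \<V>[OF W(1)] W(2) by (rule free_plotE)
    have "V \<subseteq> \<Union>\<V>"
      using V(3) W(1) by blast
    with V show "\<exists>V (N::nat) r q. openin (Euclidean_space n) V \<and> w \<in> V \<and> V \<subseteq> \<Union>\<V> \<and>
      (\<forall>i<N. smooth_fun n V (r i)) \<and> (\<forall>i<N. smooth_map n V m U (q i)) \<and>
      (\<forall>v\<in>V. p v = (\<Sum>i<N. r i v *\<^sub>R basis_vector (q i v)))"
      by (intro exI conjI)
  qed
qed

end

theory Submission
  imports Defs
begin

text \<open>
  The free space carries the quotient topology of the countably many locally compact, second
  countable spaces \<open>(\<real> \<times> U)\<^sup>N\<close>, so it is the direct limit of an increasing sequence of compact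
  sets. For Hausdorff spaces of this kind a product of two quotient maps is again a quotient map:
  a neighbourhood \<open>V \<times> W\<close> of a point is built by thickening compact rectangles step by step along
  the two sequences, using the tube lemma and the normality of compact Hausdorff spaces. Hence
  joint continuity of the vector space operations can be checked on the spaces \<open>(\<real> \<times> U)\<^sup>N\<close>.
  The linear extensions of continuous functions on \<open>U\<close> separate points. Finally, a topological
  vector space is regular, and a regular Lindelof space is normal.
\<close>

section \<open>Products of quotients of locally compact Lindelof spaces\<close>

text \<open>The data of a k_omega-space, with the Hausdorff property kept as a separate hypothesis.
  Only one implication about open sets is recorded, because traces of open sets are always
  relatively open.\<close>

definition k_omega_cover :: "'a topology \<Rightarrow> (nat \<Rightarrow> 'a set) \<Rightarrow> bool" where
  "k_omega_cover T C \<longleftrightarrow>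
     (\<forall>n. compactin T (C n)) \<and> (\<forall>n. C n \<subseteq> C (Suc n)) \<and> topspace T = (\<Union>n. C n) \<and>
     (\<forall>A \<subseteq> topspace T. (\<forall>n. openin (subtopology T (C n)) (A \<inter> C n)) \<longrightarrow> openin T A)"

lemma k_omega_coverD:
  assumes "k_omega_cover T C"
  shows "compactin T (C n)" and "i \<le> j \<Longrightarrow> C i \<subseteq> C j" and "topspace T = (\<Union>n. C n)"
    and "A \<subseteq> topspace T \<Longrightarrow> (\<And>n. openin (subtopology T (C n)) (A \<inter> C n)) \<Longrightarrow> openin T A"
  using assms lift_Suc_mono_le[of C i j] unfolding k_omega_cover_def by blast+

text \<open>The individual \<open>K n\<close> may fail to be open in \<open>T\<close>; what counts
  is the relatively open set squeezed between consecutive ones. On a fixed \<open>C k\<close> the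
  union is that of the traces of \<open>U n\<close> with \<open>n \<ge> k\<close>, and these are
  relatively open because \<open>C k\<close> lies in \<open>C (n0 + Suc n)\<close>.\<close>

lemma openin_k_omega_chain:
  assumes C: "k_omega_cover T C"
    and U: "\<And>n. openin (subtopology T (C (n0 + Suc n))) (U n)"
    and KU: "\<And>n. K n \<subseteq> U n" and UK: "\<And>n. U n \<subseteq> K (Suc n)"
  shows "openin T (\<Union>n. K n)"
proof (rule k_omega_coverD(4)[OF C])
  have "U n \<subseteq> topspace T" for n
    using openin_subset[OF U] by simp
  then show "(\<Union>n. K n) \<subseteq> topspace T"
    using KU by blast
  fix k
  have incU: "U i \<subseteq> U j" if "i \<le> j" for i j
    using lift_Suc_mono_le[of U i j] that KU UK by blast
  have "(\<Union>n. K n) \<inter> C k = (\<Union>n\<in>{k..}. U n \<inter> C k)"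
  proof (intro equalityI subsetI)
    fix x assume "x \<in> (\<Union>n. K n) \<inter> C k"
    then obtain n where "x \<in> U n" "x \<in> C k"
      using KU by blast
    then have "x \<in> U (max n k) \<inter> C k"
      using incU[of n "max n k"] by auto
    then show "x \<in> (\<Union>n\<in>{k..}. U n \<inter> C k)"
      by (meson UN_I atLeast_iff max.cobounded2)
  qed (use UK in blast)
  moreover have "openin (subtopology T (C k)) (U n \<inter> C k)" if "k \<le> n" for n
  proof -
    obtain O' where "openin T O'" "U n = O' \<inter> C (n0 + Suc n)"
      using U[of n] unfolding openin_subtopology by blast
    moreover have "C k \<subseteq> C (n0 + Suc n)"
      using that by (intro k_omega_coverD(2)[OF C]) simp
    ultimately show ?thesis
      unfolding openin_subtopology by blast
  qed
  then have "openin (subtopology T (C k)) (\<Union>n\<in>{k..}. U n \<inter> C k)"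
    by (intro openin_Union) auto
  ultimately show "openin (subtopology T (C k)) ((\<Union>n. K n) \<inter> C k)"
    by metis
qed

text \<open>The tube lemma in the subspaces \<open>C\<close> and \<open>D\<close> puts an open
  rectangle between \<open>K \<times> L\<close> and \<open>A\<close>. These subspaces are compact
  Hausdorff, hence normal, so each side shrinks to an open set whose closure stays inside. The
  closures are \<open>K'\<close> and \<open>L'\<close>; the open sets in between feed
  \<open>openin_k_omega_chain\<close>.\<close>

lemma compact_rectangle_thicken:
  assumes T1: "Hausdorff_space T1" "compactin T1 C" and T2: "Hausdorff_space T2" "compactin T2 D"
    and A: "openin (subtopology (prod_topology T1 T2) (C \<times> D)) (A \<inter> C \<times> D)"
    and K: "compactin T1 K" "K \<subseteq> C" and L: "compactin T2 L" "L \<subseteq> D" and KL: "K \<times> L \<subseteq> A"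
  obtains K' L' U V where "compactin T1 K'" "K' \<subseteq> C" "compactin T2 L'" "L' \<subseteq> D" "K' \<times> L' \<subseteq> A"
    "openin (subtopology T1 C) U" "K \<subseteq> U" "U \<subseteq> K'"
    "openin (subtopology T2 D) V" "L \<subseteq> V" "V \<subseteq> L'"
proof -
  have thick: "\<exists>V V'. openin (subtopology T C) V \<and> K \<subseteq> V \<and> V \<subseteq> V' \<and> V' \<subseteq> U \<and> V' \<subseteq> C \<and> compactin T V'"
    if T: "Hausdorff_space T" "compactin T C" and K: "compactin T K" "K \<subseteq> C"
      and U: "openin (subtopology T C) U" "K \<subseteq> U" for T :: "'x topology" and C K U
  proof -
    have c: "compact_space (subtopology T C)" "Hausdorff_space (subtopology T C)"
      using T by (auto simp: compact_space_subtopology Hausdorff_space_subtopology)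
    have "closedin (subtopology T C) K"
      using c(2) K by (intro compactin_imp_closedin) (auto simp: compactin_subtopology)
    then obtain V where V: "openin (subtopology T C) V" "K \<subseteq> V" "(subtopology T C) closure_of V \<subseteq> U"
      using compact_Hausdorff_or_regular_imp_normal_space[OF c(1)] c(2) U
      unfolding normal_space_alt by blast
    have "compactin (subtopology T C) ((subtopology T C) closure_of V)"
      using c(1) by (intro closedin_compact_space) auto
    moreover have "V \<subseteq> (subtopology T C) closure_of V"
      using openin_subset[OF V(1)] by (rule closure_of_subset)
    ultimately show ?thesis
      using V by (auto simp: compactin_subtopology)
  qed
  have "openin (prod_topology (subtopology T1 C) (subtopology T2 D)) (A \<inter> C \<times> D)"
    using A by (simp add: subtopology_Times)
  then obtain U V where UV: "openin (subtopology T1 C) U" "openin (subtopology T2 D) V" "K \<subseteq> U" "L \<subseteq> V"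
    "U \<times> V \<subseteq> A \<inter> C \<times> D"
    using Wallace_theorem_prod_topology[of "subtopology T1 C" K "subtopology T2 D" L "A \<inter> C \<times> D"] K L KL
    by (metis Int_greatest Sigma_mono compactin_subtopology)
  obtain U' K' where U': "openin (subtopology T1 C) U'" "K \<subseteq> U'" "U' \<subseteq> K'" "K' \<subseteq> U" "K' \<subseteq> C" "compactin T1 K'"
    using thick[OF T1 K UV(1,3)] by blast
  obtain V' L' where V': "openin (subtopology T2 D) V'" "L \<subseteq> V'" "V' \<subseteq> L'" "L' \<subseteq> V" "L' \<subseteq> D" "compactin T2 L'"
    using thick[OF T2 L UV(2,4)] by blast
  have "K' \<times> L' \<subseteq> A"
    using UV(5) U'(4) V'(4) by blast
  with U' V' show thesis
    by (intro that[of K' L' U' V']) auto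
qed

text \<open>Around each point of \<open>A\<close> a sequence of compact rectangles inside
  \<open>A\<close> is grown, the one at stage \<open>n\<close> within
  \<open>C (n0 + n) \<times> D (n0 + n)\<close>. The unions of the two sequences of sides are open
  by \<open>openin_k_omega_chain\<close>.\<close>

lemma openin_prod_k_omega:
  assumes C: "k_omega_cover T1 C" "Hausdorff_space T1" and D: "k_omega_cover T2 D" "Hausdorff_space T2"
    and A: "A \<subseteq> topspace T1 \<times> topspace T2"
    and open_pieces: "\<And>n. openin (subtopology (prod_topology T1 T2) (C n \<times> D n)) (A \<inter> C n \<times> D n)"
  shows "openin (prod_topology T1 T2) A"
  unfolding openin_prod_topology_alt
proof (intro allI impI)
  fix x y assume xy: "(x, y) \<in> A"
  then obtain i j where "x \<in> C i" "y \<in> D j"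
    using A k_omega_coverD(3)[OF C(1)] k_omega_coverD(3)[OF D(1)] by blast
  then obtain n0 where n0: "x \<in> C n0" "y \<in> D n0"
    using k_omega_coverD(2)[OF C(1), of i "max i j"] k_omega_coverD(2)[OF D(1), of j "max i j"]
    by (metis max.cobounded1 max.cobounded2 subsetD)
  \<comment> \<open>\<open>P\<close> is the invariant of the rectangle at stage \<open>n\<close>,
    \<open>R\<close> the thickening from one stage to the next; the \<open>Suc n\<close> in
    \<open>R\<close> is the index that \<open>openin_k_omega_chain\<close> expects.\<close>
  define P where "P n = (\<lambda>(K, L). compactin T1 K \<and> K \<subseteq> C (n0 + n) \<and> x \<in> K \<and>
      compactin T2 L \<and> L \<subseteq> D (n0 + n) \<and> y \<in> L \<and> K \<times> L \<subseteq> A)" for n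
  define R where "R n = (\<lambda>(K, L) (K', L').
      (\<exists>U. openin (subtopology T1 (C (n0 + Suc n))) U \<and> K \<subseteq> U \<and> U \<subseteq> K') \<and>
      (\<exists>V. openin (subtopology T2 (D (n0 + Suc n))) V \<and> L \<subseteq> V \<and> V \<subseteq> L'))" for n
  have "\<exists>f. \<forall>n. P n (f n) \<and> R n (f n) (f (Suc n))"
  proof (rule dependent_nat_choice)
    \<comment> \<open>The construction starts from the rectangle that is the given point.\<close>
    have "P 0 ({x}, {y})"
      using xy n0 A by (auto simp: P_def)
    then show "\<exists>s. P 0 s" ..
  next
    fix s n assume "P n s"
    then obtain K L where s: "s = (K, L)" and K: "compactin T1 K" "K \<subseteq> C (n0 + n)" "x \<in> K"
      and L: "compactin T2 L" "L \<subseteq> D (n0 + n)" "y \<in> L" and KL: "K \<times> L \<subseteq> A"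
      by (auto simp: P_def)
    have "K \<subseteq> C (n0 + Suc n)" "L \<subseteq> D (n0 + Suc n)"
      using K(2) L(2) k_omega_coverD(2)[OF C(1), of "n0 + n" "n0 + Suc n"]
        k_omega_coverD(2)[OF D(1), of "n0 + n" "n0 + Suc n"] by auto
    then obtain K' L' U V where "compactin T1 K'" "K' \<subseteq> C (n0 + Suc n)"
      "compactin T2 L'" "L' \<subseteq> D (n0 + Suc n)" "K' \<times> L' \<subseteq> A"
      "openin (subtopology T1 (C (n0 + Suc n))) U" "K \<subseteq> U" "U \<subseteq> K'"
      "openin (subtopology T2 (D (n0 + Suc n))) V" "L \<subseteq> V" "V \<subseteq> L'"
      using compact_rectangle_thicken[OF C(2) k_omega_coverD(1)[OF C(1)] D(2) k_omega_coverD(1)[OF D(1)]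
          open_pieces K(1) _ L(1) _ KL] by metis
    with K L have "P (Suc n) (K', L') \<and> R n s (K', L')"
      unfolding P_def R_def s by blast
    then show "\<exists>s'. P (Suc n) s' \<and> R n s s'" ..
  qed
  then obtain f where f: "\<And>n. P n (f n)" "\<And>n. R n (f n) (f (Suc n))"
    by blast
  define K L where "K n = fst (f n)" and "L n = snd (f n)" for n
  have P: "x \<in> K n" "y \<in> L n" "K n \<times> L n \<subseteq> A" for n
    using f(1)[of n] by (auto simp: P_def K_def L_def)
  have "\<forall>n. \<exists>U. openin (subtopology T1 (C (n0 + Suc n))) U \<and> K n \<subseteq> U \<and> U \<subseteq> K (Suc n)"
    "\<forall>n. \<exists>V. openin (subtopology T2 (D (n0 + Suc n))) V \<and> L n \<subseteq> V \<and> V \<subseteq> L (Suc n)"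
    using f(2) by (simp_all add: R_def K_def L_def case_prod_beta)
  then obtain U V where U: "\<And>n. openin (subtopology T1 (C (n0 + Suc n))) (U n)"
      "\<And>n. K n \<subseteq> U n" "\<And>n. U n \<subseteq> K (Suc n)"
    and V: "\<And>n. openin (subtopology T2 (D (n0 + Suc n))) (V n)"
      "\<And>n. L n \<subseteq> V n" "\<And>n. V n \<subseteq> L (Suc n)"
    by metis
  have inc: "K i \<subseteq> K j" "L i \<subseteq> L j" if "i \<le> j" for i j
    using lift_Suc_mono_le[of K i j] lift_Suc_mono_le[of L i j] that U(2,3) V(2,3) by blast+
  show "\<exists>U V. openin T1 U \<and> openin T2 V \<and> x \<in> U \<and> y \<in> V \<and> U \<times> V \<subseteq> A"
  proof (intro exI conjI)
    show "openin T1 (\<Union>n. K n)" "openin T2 (\<Union>n. L n)"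
      using openin_k_omega_chain[OF C(1) U] openin_k_omega_chain[OF D(1) V] by auto
    show "x \<in> (\<Union>n. K n)" "y \<in> (\<Union>n. L n)"
      using P by blast+
    show "(\<Union>n. K n) \<times> (\<Union>n. L n) \<subseteq> A"
    proof clarify
      \<comment> \<open>Both sequences increase, so sides taken from different stages meet in the
        rectangle of stage \<open>max i j\<close>.\<close>
      fix a b i j assume "a \<in> K i" "b \<in> L j"
      then have "a \<in> K (max i j)" "b \<in> L (max i j)"
        using inc[of i "max i j"] inc[of j "max i j"] by auto
      then show "(a, b) \<in> A"
        using P(3) by blast
    qed
  qed
qed

section \<open>Quotient covers and products of them\<close>

text \<open>Says that the maps \<open>q i\<close> together form a quotient map from the topological
  sum of the \<open>Y i\<close>, without forming that sum.\<close>

definition quotient_cover :: "'a topology \<Rightarrow> (nat \<Rightarrow> 'b topology) \<Rightarrow> (nat \<Rightarrow> 'b \<Rightarrow> 'a) \<Rightarrow> bool" where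
  "quotient_cover T Y q \<longleftrightarrow>
     (\<forall>i. continuous_map (Y i) T (q i)) \<and> topspace T = (\<Union>i. q i ` topspace (Y i)) \<and>
     (\<forall>A \<subseteq> topspace T. (\<forall>i. openin (Y i) {y \<in> topspace (Y i). q i y \<in> A}) \<longrightarrow> openin T A)"

lemma quotient_coverD:
  assumes "quotient_cover T Y q"
  shows "continuous_map (Y i) T (q i)" and "topspace T = (\<Union>i. q i ` topspace (Y i))"
    and "A \<subseteq> topspace T \<Longrightarrow> (\<And>i. openin (Y i) {y \<in> topspace (Y i). q i y \<in> A}) \<Longrightarrow> openin T A"
  using assms unfolding quotient_cover_def by simp_all

text \<open>By local compactness the interiors of compact sets cover \<open>Y\<close>; the Lindelof
  property leaves countably many of them.\<close>

lemma compact_interior_cover: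
  assumes "locally_compact_space Y" "Lindelof_space Y"
  obtains Q :: "nat \<Rightarrow> 'b set" where "\<And>k. compactin Y (Q k)" "topspace Y = (\<Union>k. Y interior_of Q k)"
proof -
  define \<U> where "\<U> = {Y interior_of K | K. compactin Y K}"
  have "\<Union>\<U> = topspace Y"
  proof
    show "topspace Y \<subseteq> \<Union>\<U>"
    proof
      fix x assume "x \<in> topspace Y"
      then obtain U K where "openin Y U" "compactin Y K" "x \<in> U" "U \<subseteq> K"
        using assms(1) unfolding locally_compact_space_def by blast
      then have "x \<in> Y interior_of K"
        using interior_of_maximal by blast
      then show "x \<in> \<Union>\<U>"
        using \<open>compactin Y K\<close> by (auto simp: \<U>_def)
    qed
  qed (use interior_of_subset_topspace in \<open>force simp: \<U>_def\<close>)
  moreover have "\<And>U. U \<in> \<U> \<Longrightarrow> openin Y U"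
    by (auto simp: \<U>_def)
  ultimately obtain \<V> where \<V>: "countable \<V>" "\<V> \<subseteq> \<U>" "\<Union>\<V> = topspace Y"
    using Lindelof_spaceD[OF assms(2)] by metis
  obtain \<K> where \<K>: "countable \<K>" "\<K> \<subseteq> {K. compactin Y K}" "\<V> = (\<lambda>K. Y interior_of K) ` \<K>"
    using \<V>(1,2) countable_subset_image[of \<V> "\<lambda>K. Y interior_of K" "{K. compactin Y K}"]
    unfolding \<U>_def by (auto simp: setcompr_eq_image)
  \<comment> \<open>The empty set is added so that the family can be enumerated even if it is empty;
    its interior contributes nothing to the union.\<close>
  define Q where "Q = from_nat_into (insert {} \<K>)"
  have Q: "range Q = insert {} \<K>"
    unfolding Q_def using \<K>(1) by (intro range_from_nat_into) auto
  show thesis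
  proof (rule that)
    fix k have "Q k \<in> insert {} \<K>"
      using Q by blast
    then show "compactin Y (Q k)"
      using \<K>(2) by auto
  next
    have "(\<Union>k. Y interior_of Q k) = \<Union>((\<lambda>K. Y interior_of K) ` range Q)"
      by blast
    then show "topspace Y = (\<Union>k. Y interior_of Q k)"
      unfolding Q using \<V>(3) \<K>(3) by simp
  qed
qed

text \<open>A preimage in \<open>Y i\<close> is open once it is open on the interior of each
  \<open>Q i k\<close>, and \<open>q i\<close> maps \<open>Q i k\<close> into the single set
  \<open>C (max i k)\<close>. The cover is given explicitly because the product theorem lifts its
  rectangles back to the \<open>Q i k\<close>.\<close>

lemma quotient_cover_imp_k_omega_cover:
  assumes q: "quotient_cover T Y q"
    and Y: "\<And>i. locally_compact_space (Y i)" "\<And>i. Lindelof_space (Y i)"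
  obtains Q where "\<And>i k. compactin (Y i) (Q i k)"
    "k_omega_cover T (\<lambda>n. \<Union>i\<le>n. \<Union>k\<le>n. q i ` Q i k)"
proof -
  note cont = quotient_coverD(1)[OF q] and top = quotient_coverD(2)[OF q] and quot = quotient_coverD(3)[OF q]
  have "\<forall>i. \<exists>Q :: nat \<Rightarrow> _. (\<forall>k. compactin (Y i) (Q k)) \<and> topspace (Y i) = (\<Union>k. Y i interior_of Q k)"
    using compact_interior_cover[OF Y] by metis
  then obtain Q where Q: "\<And>i k. compactin (Y i) (Q i k)"
    "\<And>i. topspace (Y i) = (\<Union>k::nat. Y i interior_of Q i k)"
    by metis
  define C where "C n = (\<Union>i\<le>n. \<Union>k\<le>n. q i ` Q i k)" for n
  have QC: "q i ` Q i k \<subseteq> C (max i k)" for i k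
  proof -
    have "i \<le> max i k" "k \<le> max i k"
      by auto
    then show ?thesis unfolding C_def by blast
  qed
  have "k_omega_cover T C"
    unfolding k_omega_cover_def
  proof (intro conjI allI impI)
    show comp: "compactin T (C n)" for n
      unfolding C_def by (auto intro!: compactin_Union image_compactin[OF Q(1) cont])
    show "C n \<subseteq> C (Suc n)" for n
      unfolding C_def by (intro UN_mono) auto
    show "topspace T = (\<Union>n. C n)"
    proof
      show "(\<Union>n. C n) \<subseteq> topspace T"
        using comp compactin_subset_topspace by blast
      have "q i ` topspace (Y i) \<subseteq> (\<Union>n. C n)" for i
      proof -
        have "topspace (Y i) \<subseteq> (\<Union>k. Q i k)"
          using interior_of_subset[of "Y i"] unfolding Q(2) by blast
        then have "q i ` topspace (Y i) \<subseteq> (\<Union>k. q i ` Q i k)"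
          by (metis image_UN image_mono)
        also have "\<dots> \<subseteq> (\<Union>n. C n)"
          using QC by (intro UN_least) (metis UN_upper UNIV_I order_trans)
        finally show ?thesis .
      qed
      then show "topspace T \<subseteq> (\<Union>n. C n)"
        unfolding top by (intro UN_least)
    qed
    fix A assume AT: "A \<subseteq> topspace T" and A: "\<forall>n. openin (subtopology T (C n)) (A \<inter> C n)"
    show "openin T A"
    proof (rule quot[OF AT])
      fix i
      have "openin (Y i) {y \<in> Y i interior_of Q i k. q i y \<in> A}" for k
      proof -
        \<comment> \<open>On the image of \<open>Q i k\<close> membership in \<open>A\<close> agrees
          with membership in the open set \<open>B\<close>.\<close>
        obtain B where B: "openin T B" "A \<inter> C (max i k) = B \<inter> C (max i k)"
          using A unfolding openin_subtopology by blast
        have "{y \<in> Y i interior_of Q i k. q i y \<in> A} =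
            Y i interior_of Q i k \<inter> {y \<in> topspace (Y i). q i y \<in> B}"
          using B(2) QC[of i k] interior_of_subset[of "Y i" "Q i k"]
            interior_of_subset_topspace[of "Y i" "Q i k"] by blast
        then show ?thesis
          using openin_continuous_map_preimage[OF cont B(1)] by (simp add: openin_Int)
      qed
      then have "openin (Y i) (\<Union>k. {y \<in> Y i interior_of Q i k. q i y \<in> A})"
        by blast
      moreover have "(\<Union>k. {y \<in> Y i interior_of Q i k. q i y \<in> A}) = {y \<in> topspace (Y i). q i y \<in> A}"
        unfolding Q(2) by blast
      ultimately show "openin (Y i) {y \<in> topspace (Y i). q i y \<in> A}"
        by simp
    qed
  qed
  then show thesis
    unfolding C_def by (rule that[OF Q(1)])
qed

text \<open>This replaces the statement that a product of two quotient maps is a quotient map.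
  Openness of a preimage is tested on the rectangles of \<open>openin_prod_k_omega\<close>, which
  are finite unions of images of compact rectangles \<open>Q i k \<times> R j l\<close>, where the
  hypothesis on \<open>f\<close> applies.\<close>

theorem continuous_map_prod_quotient_cover:
  assumes q: "quotient_cover T1 Y q" "Hausdorff_space T1"
    and Y: "\<And>i. locally_compact_space (Y i)" "\<And>i. Lindelof_space (Y i)"
    and r: "quotient_cover T2 X r" "Hausdorff_space T2"
    and X: "\<And>i. locally_compact_space (X i)" "\<And>i. Lindelof_space (X i)"
    and f: "\<And>i j. continuous_map (prod_topology (Y i) (X j)) Z (\<lambda>(a, b). f (q i a, r j b))"
  shows "continuous_map (prod_topology T1 T2) Z f"
proof -
  obtain Q where Q: "\<And>i k. compactin (Y i) (Q i k)"
    and C: "k_omega_cover T1 (\<lambda>n. \<Union>i\<le>n. \<Union>k\<le>n. q i ` Q i k)"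
    using quotient_cover_imp_k_omega_cover[OF q(1) Y] by blast
  obtain R where R: "\<And>i k. compactin (X i) (R i k)"
    and D: "k_omega_cover T2 (\<lambda>n. \<Union>i\<le>n. \<Union>k\<le>n. r i ` R i k)"
    using quotient_cover_imp_k_omega_cover[OF r(1) X] by blast
  define C' where "C' n = (\<Union>i\<le>n. \<Union>k\<le>n. q i ` Q i k)" for n
  define D' where "D' n = (\<Union>i\<le>n. \<Union>k\<le>n. r i ` R i k)" for n
  let ?P = "prod_topology T1 T2"
  note top = quotient_coverD(2)[OF q(1)] quotient_coverD(2)[OF r(1)]
    and cont = quotient_coverD(1)[OF q(1)] quotient_coverD(1)[OF r(1)]
  have fZ: "f p \<in> topspace Z" if "p \<in> topspace ?P" for p
  proof -
    obtain i a j b where "p = (q i a, r j b)" "a \<in> topspace (Y i)" "b \<in> topspace (X j)"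
      using \<open>p \<in> topspace ?P\<close> by (auto simp: top)
    then show ?thesis
      using continuous_map_image_subset_topspace[OF f[of i j]] by fastforce
  qed
  have Haus: "Hausdorff_space ?P"
    by (simp add: Hausdorff_space_prod_topology q(2) r(2))
  show ?thesis
    unfolding continuous_map_def
  proof (intro conjI allI impI)
    fix O' assume O': "openin Z O'"
    show "openin ?P {p \<in> topspace ?P. f p \<in> O'}" (is "openin _ ?A")
    proof (rule openin_prod_k_omega[OF C q(2) D r(2)], goal_cases)
      case (2 n)
      \<comment> \<open>Inside a compact rectangle the complement is a finite union of images of compact sets.\<close>
      define B where "B i k j l = {p \<in> Q i k \<times> R j l. f (q i (fst p), r j (snd p)) \<in> topspace Z - O'}" for i k j l
      define E where "E = (\<Union>i\<le>n. \<Union>k\<le>n. \<Union>j\<le>n. \<Union>l\<le>n. (\<lambda>(a, b). (q i a, r j b)) ` B i k j l)"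
      have Bc: "compactin (prod_topology (Y i) (X j)) (B i k j l)" for i k j l
      proof -
        have "closedin (prod_topology (Y i) (X j))
            {p \<in> topspace (prod_topology (Y i) (X j)). (\<lambda>(a, b). f (q i a, r j b)) p \<in> topspace Z - O'}"
          using O' by (intro closedin_continuous_map_preimage[OF f]) auto
        then have "compactin (prod_topology (Y i) (X j)) (Q i k \<times> R j l \<inter>
            {p \<in> topspace (prod_topology (Y i) (X j)). (\<lambda>(a, b). f (q i a, r j b)) p \<in> topspace Z - O'})"
          using Q R by (intro compact_Int_closedin) (auto simp: compactin_Times)
        moreover have "Q i k \<times> R j l \<subseteq> topspace (prod_topology (Y i) (X j))"
          using compactin_subset_topspace[OF Q, of i k] compactin_subset_topspace[OF R, of j l] by auto
        then have "Q i k \<times> R j l \<inter>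
            {p \<in> topspace (prod_topology (Y i) (X j)). (\<lambda>(a, b). f (q i a, r j b)) p \<in> topspace Z - O'} = B i k j l"
          unfolding B_def by auto
        ultimately show ?thesis by simp
      qed
      have qr: "continuous_map (prod_topology (Y i) (X j)) ?P (\<lambda>(a, b). (q i a, r j b))" for i j
        using cont by (simp add: continuous_map_prod_top)
      have "compactin ?P E"
        unfolding E_def by (auto intro!: compactin_Union image_compactin[OF Bc qr])
      then have E: "closedin ?P E"
        by (rule compactin_imp_closedin[OF Haus])
      have sub: "C' n \<times> D' n \<subseteq> topspace ?P"
        using compactin_subset_topspace[OF k_omega_coverD(1)[OF C, of n]]
          compactin_subset_topspace[OF k_omega_coverD(1)[OF D, of n]]
        unfolding C'_def D'_def topspace_prod_topology by (rule Sigma_mono)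
      have "p \<in> E \<longleftrightarrow> f p \<notin> O'" if p: "p \<in> C' n \<times> D' n" for p
      proof
        assume "p \<in> E"
        then show "f p \<notin> O'"
          unfolding E_def B_def by auto
      next
        assume pO: "f p \<notin> O'"
        obtain i k a j l b where *: "i \<le> n" "k \<le> n" "a \<in> Q i k" "j \<le> n" "l \<le> n" "b \<in> R j l"
          and pab: "p = (q i a, r j b)"
          using p unfolding C'_def D'_def by blast
        have "(a, b) \<in> B i k j l"
          using * pO fZ[OF subsetD[OF sub p]] unfolding B_def pab by simp
        then have "p \<in> (\<lambda>(a, b). (q i a, r j b)) ` B i k j l"
          unfolding pab by (intro image_eqI[of _ _ "(a, b)"]) simp_all
        then show "p \<in> E"
          unfolding E_def by (intro UN_I[of i] UN_I[of k] UN_I[of j] UN_I[of l]) (simp_all add: *)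
      qed
      then have "?A \<inter> C' n \<times> D' n = (topspace ?P - E) \<inter> C' n \<times> D' n"
        using sub by blast
      then show ?case
        using E unfolding C'_def D'_def openin_subtopology by blast
    qed auto
  qed (use fZ in auto)
qed


section \<open>Regularity and the Lindelof property\<close>

text \<open>Negation is scaling by the constant -1, so subtraction is a composite of the two given
  operations.\<close>

lemma topological_vector_space_diff:
  assumes "topological_vector_space T"
  shows "continuous_map (prod_topology T T) T (\<lambda>(x, y). x - y)"
proof -
  have add: "continuous_map (prod_topology T T) T (\<lambda>(x, y). x + y)"
    and scale: "continuous_map (prod_topology euclideanreal T) T (\<lambda>(c, x). c *\<^sub>R x)"
    using assms unfolding topological_vector_space_def by auto
  have "continuous_map (prod_topology T T) (prod_topology euclideanreal T) (\<lambda>p. (- 1, snd p))"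
    by (simp add: continuous_map_paired continuous_map_snd)
  from continuous_map_compose[OF this scale]
  have "continuous_map (prod_topology T T) T (\<lambda>p. - snd p)"
    by (simp add: o_def)
  then have "continuous_map (prod_topology T T) (prod_topology T T) (\<lambda>p. (fst p, - snd p))"
    by (simp add: continuous_map_paired continuous_map_fst)
  from continuous_map_compose[OF this add] show ?thesis
    by (simp add: o_def case_prod_beta')
qed

text \<open>Continuity of subtraction at \<open>(a, 0)\<close> gives neighbourhoods \<open>V\<close>
  of \<open>a\<close> and \<open>W\<close> of 0 with \<open>V - W\<close> disjoint from
  \<open>C\<close>. If \<open>z\<close> is in the closure of \<open>V\<close>, its neighbourhood
  \<open>z + W\<close> contains some \<open>v\<close> in \<open>V\<close>, and then
  \<open>z = v - (v - z)\<close> lies outside \<open>C\<close>.\<close>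

lemma topological_vector_space_imp_regular:
  assumes T: "topological_vector_space T"
  shows "regular_space T"
  unfolding regular_space
proof (intro allI impI, elim conjE)
  fix C a assume C: "closedin T C" and a: "a \<in> topspace T - C"
  have "0 \<in> topspace T"
    using T by (simp add: topological_vector_space_def subspace_0)
  note diff = topological_vector_space_diff[OF T]
  have "openin (prod_topology T T) {p \<in> topspace (prod_topology T T). (\<lambda>(x, y). x - y) p \<in> topspace T - C}"
    using C by (intro openin_continuous_map_preimage[OF diff]) auto
  then obtain V W where V: "openin T V" "a \<in> V" and W: "openin T W" "0 \<in> W"
    and VW: "V \<times> W \<subseteq> {p \<in> topspace (prod_topology T T). (\<lambda>(x, y). x - y) p \<in> topspace T - C}"
    using a \<open>0 \<in> topspace T\<close> unfolding openin_prod_topology_alt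
    by (elim allE[of _ a] allE[of _ 0]) (auto simp: case_prod_beta)
  have "z \<notin> T closure_of V" if "z \<in> C" for z
  proof
    assume z: "z \<in> T closure_of V"
    then have zT: "z \<in> topspace T"
      by (simp add: in_closure_of)
    have "continuous_map T (prod_topology T T) (\<lambda>v. (v, z))"
      using zT by (simp add: continuous_map_paired)
    from continuous_map_compose[OF this diff] have "continuous_map T T (\<lambda>v. v - z)"
      by (simp add: o_def)
    from openin_continuous_map_preimage[OF this W(1)]
    have "openin T {v \<in> topspace T. v - z \<in> W}" (is "openin T ?N") .
    moreover have "z \<in> ?N"
      using zT W(2) by simp
    ultimately have "\<exists>v. v \<in> V \<and> v \<in> ?N"
      using z unfolding in_closure_of by (elim conjE allE[of _ ?N]) (rule mp, assumption, intro conjI)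
    then obtain v where "v \<in> V" "v - z \<in> W"
      by blast
    then have "v - (v - z) \<notin> C"
      using subsetD[OF VW, of "(v, v - z)"] by simp
    then show False
      using \<open>z \<in> C\<close> by simp
  qed
  then show "\<exists>U. openin T U \<and> a \<in> U \<and> disjnt C (T closure_of U)"
    using V by (auto simp: disjnt_iff)
qed

text \<open>Continuous images and countable unions of Lindelof spaces are Lindelof.\<close>

lemma quotient_cover_Lindelof:
  assumes q: "quotient_cover T Y q" and Y: "\<And>i. Lindelof_space (Y i)"
  shows "Lindelof_space T"
proof -
  have "Lindelof_space (subtopology T (\<Union>i. q i ` topspace (Y i)))"
  proof (rule Lindelof_space_Union)
    fix S assume "S \<in> range (\<lambda>i. q i ` topspace (Y i))"
    then obtain i where S: "S = q i ` topspace (Y i)"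
      by blast
    show "Lindelof_space (subtopology T S)"
    proof (rule Lindelof_space_continuous_map_image[OF Y])
      show "continuous_map (Y i) (subtopology T S) (q i)"
        using quotient_coverD(1)[OF q] unfolding S by (auto simp: continuous_map_in_subtopology)
      show "q i ` topspace (Y i) = topspace (subtopology T S)"
        unfolding S using continuous_map_image_subset_topspace[OF quotient_coverD(1)[OF q]] by auto
    qed
  qed simp
  then show ?thesis
    by (simp flip: quotient_coverD(2)[OF q])
qed


section \<open>The D-topology of the free space as a quotient\<close>

lemma second_countable_Euclidean_space: "second_countable (Euclidean_space n)"
proof -
  have "\<exists>\<B> :: (nat \<Rightarrow> real) set set. countable \<B> \<and> (\<forall>V\<in>\<B>. open V) \<and>
      (\<forall>U x. open U \<and> x \<in> U \<longrightarrow> (\<exists>V\<in>\<B>. x \<in> V \<and> V \<subseteq> U))"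
    using ex_countable_basis topological_basisE topological_basis_open by metis
  then have "second_countable (euclidean :: (nat \<Rightarrow> real) topology)"
    unfolding second_countable_def by simp
  then show ?thesis
    unfolding Euclidean_space_def euclidean_product_topology by (rule second_countable_subtopology)
qed

lemma continuous_map_Euclidean_coordinate:
  "continuous_map (Euclidean_space n) euclideanreal (\<lambda>x. x i)"
  unfolding Euclidean_space_def
  using continuous_map_from_subtopology continuous_map_product_coordinates[of i UNIV "\<lambda>_. euclideanreal"]
  by blast

text \<open>The first partial derivatives are the constants 0 and 1, so a case split on the order
  replaces an induction.\<close>

lemma smooth_fun_coordinate: "smooth_fun n W (\<lambda>x. x j)"
proof -
  have "C_k_on k n W (\<lambda>x. x j)" for k
  proof (cases k)
    case 0
    then show ?thesis
      by (simp add: continuous_map_from_subtopology continuous_map_Euclidean_coordinate)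
  next
    case (Suc k')
    have "partial_deriv i (\<lambda>x. x j) = (\<lambda>_. if i = j then 1 else 0)" for i
      by (auto simp: partial_deriv_def fun_eq_iff)
    moreover have "(\<lambda>t. (x(i := t)) j) differentiable at (x i)" for x i
      by (cases "i = j") simp_all
    ultimately show ?thesis
      unfolding Suc C_k_on.simps
      by (auto simp del: fun_upd_apply simp: C_k_on_const continuous_map_from_subtopology continuous_map_Euclidean_coordinate)
  qed
  then show ?thesis by (simp add: smooth_fun_def)
qed

abbreviation free_topology :: "nat \<Rightarrow> (nat \<Rightarrow> real) set \<Rightarrow> ((nat \<Rightarrow> real) \<Rightarrow>\<^sub>0 real) topology" where
  "free_topology m U \<equiv> D_topology (free_vector_space U) (free_plot m U)"

text \<open>
  A point of \<open>(\<real> \<times> U)\<^sup>N\<close> is encoded by \<open>N\<close> consecutive blocks of length \<open>m + 1\<close>: each block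
  holds the coefficient followed by the coordinates of the point of \<open>U\<close>.
\<close>

declare mult_Suc_right [simp del]

definition block_point :: "nat \<Rightarrow> (nat \<Rightarrow> real) \<Rightarrow> nat \<Rightarrow> nat \<Rightarrow> real" where
  "block_point m w i = (\<lambda>j. if j < m then w (i * Suc m + Suc j) else 0)"

definition comb_domain :: "nat \<Rightarrow> (nat \<Rightarrow> real) set \<Rightarrow> nat \<Rightarrow> (nat \<Rightarrow> real) set" where
  "comb_domain m U N = {w \<in> topspace (Euclidean_space (N * Suc m)). \<forall>i<N. block_point m w i \<in> U}"

text \<open>The canonical map \<rho> with \<open>N\<close> terms, read in block coordinates. With
  \<open>N = 0\<close> included, the zero vector is reached even when \<open>U\<close> is
  empty.\<close>

definition comb :: "nat \<Rightarrow> nat \<Rightarrow> (nat \<Rightarrow> real) \<Rightarrow> ((nat \<Rightarrow> real) \<Rightarrow>\<^sub>0 real)" where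
  "comb m N w = (\<Sum>i<N. w (i * Suc m) *\<^sub>R basis_vector (block_point m w i))"

abbreviation comb_space :: "nat \<Rightarrow> (nat \<Rightarrow> real) set \<Rightarrow> nat \<Rightarrow> (nat \<Rightarrow> real) topology" where
  "comb_space m U N \<equiv> subtopology (Euclidean_space (N * Suc m)) (comb_domain m U N)"

lemma continuous_map_block_point:
  "continuous_map (Euclidean_space n) (Euclidean_space m) (\<lambda>w. block_point m w i)"
  unfolding block_point_def continuous_map_componentwise_Euclidean_space
  using continuous_map_Euclidean_coordinate by blast

lemma topspace_comb_space: "topspace (comb_space m U N) = comb_domain m U N"
  by (auto simp: comb_domain_def)

lemma Lindelof_comb_space: "Lindelof_space (comb_space m U N)"
  by (intro second_countable_imp_Lindelof_space second_countable_subtopology second_countable_Euclidean_space)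

lemma block_index:
  assumes "i < N" "j \<le> m"
  shows "i * Suc m + j < N * Suc m"
proof -
  have "i * Suc m + j < Suc i * Suc m"
    using assms by simp
  also have "\<dots> \<le> N * Suc m"
    using assms by (intro mult_le_mono1) simp
  finally show ?thesis .
qed

section \<open>Packing coefficients and points into blocks\<close>

text \<open>A section of the block reading: the quotient by \<open>Suc m\<close> is the block
  number, remainder 0 marks the coefficient, and the shift by 1 recovers the coordinate of the
  point. The default 0 keeps the result in Euclidean space.\<close>

definition encode :: "nat \<Rightarrow> nat \<Rightarrow> (nat \<Rightarrow> real) \<Rightarrow> (nat \<Rightarrow> nat \<Rightarrow> real) \<Rightarrow> nat \<Rightarrow> real" where
  "encode m N r q = (\<lambda>k. if k < N * Suc m then
     (if k mod Suc m = 0 then r (k div Suc m) else q (k div Suc m) (k mod Suc m - 1)) else 0)"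

lemma encode_coeff: "i < N \<Longrightarrow> encode m N r q (i * Suc m) = r i"
  using block_index[of i N 0 m] unfolding encode_def by simp

lemma block_point_encode:
  assumes "i < N" "q i \<in> topspace (Euclidean_space m)"
  shows "block_point m (encode m N r q) i = q i"
proof
  fix j
  show "block_point m (encode m N r q) i j = q i j"
  proof (cases "j < m")
    case True
    have "(i * Suc m + Suc j) mod Suc m = Suc j" "(i * Suc m + Suc j) div Suc m = i"
      using True mod_mult_self3[of i "Suc m" "Suc j"] div_mult_self3[of "Suc m" i "Suc j"]
      by (simp_all del: add_Suc_right)
    then show ?thesis
      using True block_index[OF assms(1), of "Suc j" m] by (simp add: block_point_def encode_def)
  next
    case False
    then show ?thesis
      using assms(2) by (simp add: block_point_def topspace_Euclidean_space)
  qed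
qed

lemma comb_encode:
  assumes "\<And>i. i < N \<Longrightarrow> q i \<in> topspace (Euclidean_space m)"
  shows "comb m N (encode m N r q) = (\<Sum>i<N. r i *\<^sub>R basis_vector (q i))"
  unfolding comb_def using assms by (intro sum.cong) (auto simp: encode_coeff block_point_encode)

text \<open>The position \<open>k\<close> alone decides which entry is read, so every coordinate is
  a single continuous function of \<open>x\<close>.\<close>

lemma continuous_map_encode:
  assumes U: "U \<subseteq> topspace (Euclidean_space m)"
    and r: "\<And>i. i < N \<Longrightarrow> continuous_map X euclideanreal (\<lambda>x. r x i)"
    and q: "\<And>i. i < N \<Longrightarrow> continuous_map X (subtopology (Euclidean_space m) U) (\<lambda>x. q x i)"
  shows "continuous_map X (comb_space m U N) (\<lambda>x. encode m N (r x) (q x))"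
  unfolding continuous_map_in_subtopology
proof (intro conjI image_subsetI Pi_I)
  have "continuous_map X euclideanreal (\<lambda>x. if k mod Suc m = 0 then r x (k div Suc m)
      else q x (k div Suc m) (k mod Suc m - 1))" if "k < N * Suc m" for k
  proof -
    have "k div Suc m < N"
      using that by (simp add: less_mult_imp_div_less)
    moreover have "continuous_map X euclideanreal (\<lambda>x. q x i j)" if "i < N" for i j
      using continuous_map_compose[OF _ continuous_map_Euclidean_coordinate[of m j]]
        q[OF that, THEN continuous_map_into_fulltopology] by (fastforce simp: o_def)
    ultimately show ?thesis
      using r by (cases "k mod Suc m = 0") auto
  qed
  then show "continuous_map X (Euclidean_space (N * Suc m)) (\<lambda>x. encode m N (r x) (q x))"
    unfolding encode_def continuous_map_componentwise_Euclidean_space by blast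
  fix x assume x: "x \<in> topspace X"
  have "q x i \<in> U" if "i < N" for i
    using continuous_map_image_subset_topspace[OF q[OF that]] x by auto
  then show "encode m N (r x) (q x) \<in> comb_domain m U N"
    using U unfolding comb_domain_def
    by (auto simp: block_point_encode subset_iff) (auto simp: topspace_Euclidean_space encode_def)
qed

lemma openin_comb_domain:
  assumes U: "openin (Euclidean_space m) U"
  shows "openin (Euclidean_space (N * Suc m)) (comb_domain m U N)"
proof -
  let ?E = "Euclidean_space (N * Suc m)"
  have "openin ?E {w \<in> topspace ?E. block_point m w i \<in> U}" for i
    by (rule openin_continuous_map_preimage[OF continuous_map_block_point U])
  \<comment> \<open>The whole space takes part in the intersection to cover \<open>N = 0\<close>,
    where the indexed family is empty.\<close>
  then have "openin ?E (topspace ?E \<inter> \<Inter>((\<lambda>i. {w \<in> topspace ?E. block_point m w i \<in> U}) ` {..<N}))"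
    by (intro openin_Int_Inter) auto
  moreover have "topspace ?E \<inter> \<Inter>((\<lambda>i. {w \<in> topspace ?E. block_point m w i \<in> U}) ` {..<N}) = comb_domain m U N"
    unfolding comb_domain_def by blast
  ultimately show ?thesis by simp
qed

lemma comb_space_coefficients:
  "continuous_map (comb_space m U N) euclideanreal (\<lambda>w. w k)"
  by (intro continuous_map_from_subtopology continuous_map_Euclidean_coordinate)

lemma comb_space_points:
  "i < N \<Longrightarrow> continuous_map (comb_space m U N) (subtopology (Euclidean_space m) U) (\<lambda>w. block_point m w i)"
  unfolding continuous_map_in_subtopology topspace_comb_space
  by (auto intro!: continuous_map_from_subtopology continuous_map_block_point simp: comb_domain_def)

section \<open>Combination maps as universal plots\<close>

text \<open>Coefficients and points are coordinate functions here, so one representation is valid on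
  the whole domain.\<close>

lemma free_plot_comb:
  assumes U: "openin (Euclidean_space m) U"
  shows "free_plot m U (N * Suc m) (comb_domain m U N) (comb m N)"
proof (rule free_plotI[OF openin_comb_domain[OF U]], intro exI conjI)
  let ?W = "comb_domain m U N"
  fix w assume "w \<in> ?W"
  show "openin (Euclidean_space (N * Suc m)) ?W" "w \<in> ?W" "?W \<subseteq> ?W"
    using openin_comb_domain[OF U] \<open>w \<in> ?W\<close> by auto
  show "\<forall>i<N. smooth_fun (N * Suc m) ?W (\<lambda>w. w (i * Suc m))"
    by (simp only: smooth_fun_coordinate simp_thms)
  show "\<forall>i<N. smooth_map (N * Suc m) ?W m U (\<lambda>w. block_point m w i)"
    unfolding smooth_map_def
  proof (intro allI impI conjI)
    fix i assume "i < N"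
    then show "(\<lambda>w. block_point m w i) ` ?W \<subseteq> U \<inter> topspace (Euclidean_space m)"
      by (auto simp: comb_domain_def block_point_def topspace_Euclidean_space)
    show "smooth_fun (N * Suc m) ?W (\<lambda>w. block_point m w i j)" if "j < m" for j
      using that by (simp only: block_point_def if_True smooth_fun_coordinate)
  qed
  show "\<forall>v\<in>?W. comb m N v = (\<Sum>i<N. v (i * Suc m) *\<^sub>R basis_vector (block_point m v i))"
    by (simp add: comb_def)
qed

text \<open>The map \<open>g\<close> encodes the local coefficients and points of the plot. Its
  continuity suffices for pulling back open sets.\<close>

lemma free_plot_factors_through_comb:
  assumes U: "U \<subseteq> topspace (Euclidean_space m)" and p: "free_plot m U n W p" and w: "w \<in> W"
  obtains V N g where "openin (Euclidean_space n) V" "w \<in> V" "V \<subseteq> W"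
    "continuous_map (subtopology (Euclidean_space n) V) (comb_space m U N) g"
    "\<And>v. v \<in> V \<Longrightarrow> p v = comb m N (g v)"
proof -
  obtain V and N :: nat and r q where V: "openin (Euclidean_space n) V" "w \<in> V" "V \<subseteq> W"
    and r: "\<forall>i<N. smooth_fun n V (r i)" and q: "\<forall>i<N. smooth_map n V m U (q i)"
    and eq: "\<forall>v\<in>V. p v = (\<Sum>i<N. r i v *\<^sub>R basis_vector (q i v))"
    using p w by (rule free_plotE)
  show thesis
  proof (rule that[OF V])
    have "continuous_map (subtopology (Euclidean_space n) V) euclideanreal (r i)" if "i < N" for i
      using r that C_k_on_continuous unfolding smooth_fun_def by blast
    moreover have "continuous_map (subtopology (Euclidean_space n) V) (subtopology (Euclidean_space m) U) (q i)"
      if "i < N" for i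
      using q that continuous_map_smooth_map by blast
    ultimately show "continuous_map (subtopology (Euclidean_space n) V) (comb_space m U N)
        (\<lambda>v. encode m N (\<lambda>i. r i v) (\<lambda>i. q i v))"
      by (intro continuous_map_encode[OF U]) auto
    fix v assume v: "v \<in> V"
    have "q i v \<in> topspace (Euclidean_space m)" if "i < N" for i
      using q that v unfolding smooth_map_def by blast
    then show "p v = comb m N (encode m N (\<lambda>i. r i v) (\<lambda>i. q i v))"
      using eq v by (simp add: comb_encode)
  qed
qed

context
  fixes m :: nat and U :: "(nat \<Rightarrow> real) set"
  assumes U: "openin (Euclidean_space m) U"
begin

interpretation diffeological_space "free_vector_space U" "free_plot m U"
  by (rule diffeological_space_free[OF openin_subset[OF U]])

lemma topspace_free_topology: "topspace (free_topology m U) = free_vector_space U"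
  by (rule topspace_D_topology)

lemma continuous_map_comb: "continuous_map (comb_space m U N) (free_topology m U) (comb m N)"
  using plots_continuous_topology_D_open free_plot_comb[OF U, of N]
  unfolding plots_continuous_def D_topology_eq by blast

text \<open>The maps \<open>comb m N\<close> are continuous because they are plots. Conversely every
  plot factors locally through one of them, so a set with open preimages under all of them has open
  preimages under all plots.\<close>

lemma free_topology_quotient_cover: "quotient_cover (free_topology m U) (comb_space m U) (comb m)"
  unfolding quotient_cover_def
proof (intro conjI allI impI)
  show "continuous_map (comb_space m U N) (free_topology m U) (comb m N)" for N
    by (rule continuous_map_comb)
  show "topspace (free_topology m U) = (\<Union>N. comb m N ` topspace (comb_space m U N))"
  proof
    show "(\<Union>N. comb m N ` topspace (comb_space m U N)) \<subseteq> topspace (free_topology m U)"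
      using continuous_map_image_subset_topspace[OF continuous_map_comb] by blast
    show "topspace (free_topology m U) \<subseteq> (\<Union>N. comb m N ` topspace (comb_space m U N))"
    proof
      fix x assume "x \<in> topspace (free_topology m U)"
      \<comment> \<open>A vector is a constant plot on the one-point space of dimension 0; factoring
        this plot exhibits it as a value of some \<open>comb m N\<close>.\<close>
      then have "free_plot m U 0 (topspace (Euclidean_space 0)) (\<lambda>_. x)"
        by (intro plot_const) (auto simp: topspace_free_topology)
      moreover have "(\<lambda>_. 0) \<in> topspace (Euclidean_space 0)"
        by (simp add: topspace_Euclidean_space)
      ultimately obtain V N g where V: "openin (Euclidean_space 0) V" "(\<lambda>_. 0) \<in> V"
        and g: "continuous_map (subtopology (Euclidean_space 0) V) (comb_space m U N) g"
        and x: "\<And>v. v \<in> V \<Longrightarrow> x = comb m N (g v)"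
        using free_plot_factors_through_comb[OF openin_subset[OF U]] by metis
      have "g (\<lambda>_. 0) \<in> topspace (comb_space m U N)"
        using continuous_map_image_subset_topspace[OF g] V(2)
        unfolding topspace_open_subtopology[OF V(1)] by blast
      then show "x \<in> (\<Union>N. comb m N ` topspace (comb_space m U N))"
        using x[OF V(2)] by blast
    qed
  qed
next
  fix A assume A: "A \<subseteq> topspace (free_topology m U)"
    and opens: "\<forall>N. openin (comb_space m U N) {w \<in> topspace (comb_space m U N). comb m N w \<in> A}"
  show "openin (free_topology m U) A"
    unfolding openin_D_topology
  proof (intro conjI allI impI)
    show "A \<subseteq> free_vector_space U"
      using A by (simp add: topspace_free_topology)
    fix n W p assume p: "free_plot m U n W p"
    show "openin (Euclidean_space n) {w \<in> W. p w \<in> A}"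
    proof (subst openin_subopen, intro ballI)
      fix w assume "w \<in> {w \<in> W. p w \<in> A}"
      then have w: "w \<in> W" "p w \<in> A"
        by auto
      obtain V N g where V: "openin (Euclidean_space n) V" "w \<in> V" "V \<subseteq> W"
        and g: "continuous_map (subtopology (Euclidean_space n) V) (comb_space m U N) g"
        and pg: "\<And>v. v \<in> V \<Longrightarrow> p v = comb m N (g v)"
        using free_plot_factors_through_comb[OF openin_subset[OF U] p w(1)] by blast
      let ?O = "{v \<in> V. g v \<in> {w \<in> topspace (comb_space m U N). comb m N w \<in> A}}"
      have gV: "g v \<in> topspace (comb_space m U N)" if "v \<in> V" for v
        using continuous_map_image_subset_topspace[OF g] that
        unfolding topspace_open_subtopology[OF V(1)] by blast
      have "openin (subtopology (Euclidean_space n) V) ?O"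
        using openin_continuous_map_preimage[OF g opens[rule_format, of N]]
        unfolding topspace_open_subtopology[OF V(1)] .
      then have "openin (Euclidean_space n) ?O"
        by (simp add: openin_open_subtopology[OF V(1)])
      moreover have "w \<in> ?O" "?O \<subseteq> {w \<in> W. p w \<in> A}"
        using w V gV pg by auto
      ultimately show "\<exists>S. openin (Euclidean_space n) S \<and> w \<in> S \<and> S \<subseteq> {w \<in> W. p w \<in> A}"
        by blast
    qed
  qed
qed

lemma locally_compact_comb_space: "locally_compact_space (comb_space m U N)"
  by (rule locally_compact_space_open_subset)
    (simp_all add: Hausdorff_Euclidean_space locally_compact_Euclidean_space openin_comb_domain[OF U] del: mult_Suc_right)

end


section \<open>Separation and continuity of the operations\<close>

lemma sum_lessThan_add:
  fixes f :: "nat \<Rightarrow> 'a::comm_monoid_add"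
  shows "(\<Sum>i<M + N. f i) = (\<Sum>i<M. f i) + (\<Sum>i<N. f (M + i))"
  by (induction N) (simp_all add: add.assoc)

lemma subspace_free_vector_space: "subspace (free_vector_space U)"
proof (intro subspaceI)
  fix x y :: "'a \<Rightarrow>\<^sub>0 real" and c :: real
  assume x: "x \<in> free_vector_space U"
  have "Poly_Mapping.keys (c *\<^sub>R x) \<subseteq> Poly_Mapping.keys x"
    by (auto simp: in_keys_iff lookup_scaleR_real)
  then show "c *\<^sub>R x \<in> free_vector_space U"
    using x by (auto simp: free_vector_space_def)
  assume "y \<in> free_vector_space U"
  then show "x + y \<in> free_vector_space U"
    using x Poly_Mapping.keys_add[of x y] by (auto simp: free_vector_space_def)
qed (simp add: free_vector_space_def)

section \<open>Linear extensions and the Hausdorff property\<close>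

definition lin_ext :: "('b \<Rightarrow> real) \<Rightarrow> ('b \<Rightarrow>\<^sub>0 real) \<Rightarrow> real" where
  "lin_ext \<phi> x = (\<Sum>u\<in>Poly_Mapping.keys x. Poly_Mapping.lookup x u * \<phi> u)"

text \<open>Coefficients vanish off the support; this allows several vectors to be summed over one
  common finite set.\<close>

lemma lin_ext_superset:
  assumes "finite S" "Poly_Mapping.keys x \<subseteq> S"
  shows "lin_ext \<phi> x = (\<Sum>u\<in>S. Poly_Mapping.lookup x u * \<phi> u)"
  unfolding lin_ext_def using assms by (intro sum.mono_neutral_left) (auto simp: in_keys_iff)

lemma lin_ext_add: "lin_ext \<phi> (x + y) = lin_ext \<phi> x + lin_ext \<phi> y"
proof -
  let ?S = "Poly_Mapping.keys x \<union> Poly_Mapping.keys y"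
  have S: "finite ?S" "Poly_Mapping.keys (x + y) \<subseteq> ?S"
    using Poly_Mapping.keys_add[of x y] by auto
  show ?thesis
    using lin_ext_superset[OF S] lin_ext_superset[of ?S x] lin_ext_superset[of ?S y]
    by (simp add: lookup_add distrib_right sum.distrib)
qed

lemma lin_ext_basis: "lin_ext \<phi> (c *\<^sub>R basis_vector u) = c * \<phi> u"
proof -
  have "Poly_Mapping.keys (c *\<^sub>R basis_vector u) \<subseteq> {u}"
    by (auto simp: in_keys_iff lookup_scaleR_real lookup_single when_def split: if_splits)
  from lin_ext_superset[OF _ this] show ?thesis
    by (simp add: lookup_scaleR_real)
qed

text \<open>The points \<open>q i\<close> may coincide and terms may cancel, so the value is
  obtained from additivity and not by comparing supports.\<close>

lemma lin_ext_sum: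
  "lin_ext \<phi> (\<Sum>i<(N::nat). r i *\<^sub>R basis_vector (q i)) = (\<Sum>i<N. r i * \<phi> (q i))"
proof (induction N)
  case 0
  then show ?case by (simp add: lin_ext_def)
next
  case (Suc N)
  then show ?case by (simp add: lin_ext_add lin_ext_basis)
qed

text \<open>By the quotient property continuity is tested on the spaces
  \<open>comb_space m U N\<close>, where the functional is a finite sum of coefficients times values
  of \<phi>.\<close>

lemma continuous_map_lin_ext:
  assumes U: "openin (Euclidean_space m) U"
    and \<phi>: "continuous_map (subtopology (Euclidean_space m) U) euclideanreal \<phi>"
  shows "continuous_map (free_topology m U) euclideanreal (lin_ext \<phi>)"
  unfolding continuous_map_def
proof (intro conjI allI impI)
  fix B :: "real set" assume B: "openin euclideanreal B"
  show "openin (free_topology m U) {x \<in> topspace (free_topology m U). lin_ext \<phi> x \<in> B}"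
  proof (rule quotient_coverD(3)[OF free_topology_quotient_cover[OF U]])
    fix N
    have "continuous_map (comb_space m U N) euclideanreal (\<lambda>w. \<phi> (block_point m w i))" if "i < N" for i
      using continuous_map_compose[OF comb_space_points[OF that] \<phi>] by (simp add: o_def)
    then have "continuous_map (comb_space m U N) euclideanreal (\<lambda>w. \<Sum>i<N. w (i * Suc m) * \<phi> (block_point m w i))"
      by (intro continuous_map_sum continuous_map_real_mult comb_space_coefficients) auto
    then have "continuous_map (comb_space m U N) euclideanreal (\<lambda>w. lin_ext \<phi> (comb m N w))"
      by (simp add: comb_def lin_ext_sum)
    from openin_continuous_map_preimage[OF this B]
    have "openin (comb_space m U N) {w \<in> topspace (comb_space m U N). lin_ext \<phi> (comb m N w) \<in> B}" .
    moreover have "comb m N w \<in> topspace (free_topology m U)" if "w \<in> topspace (comb_space m U N)" for w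
      using continuous_map_image_subset_topspace[OF continuous_map_comb[OF U, of N]] that by blast
    then have "{w \<in> topspace (comb_space m U N). lin_ext \<phi> (comb m N w) \<in> B} =
        {w \<in> topspace (comb_space m U N). comb m N w \<in> {x \<in> topspace (free_topology m U). lin_ext \<phi> x \<in> B}}"
      by auto
    ultimately show "openin (comb_space m U N)
        {w \<in> topspace (comb_space m U N). comb m N w \<in> {x \<in> topspace (free_topology m U). lin_ext \<phi> x \<in> B}}"
      by simp
  qed auto
qed auto

lemma lin_ext_separates:
  fixes x y :: "'b::metric_space \<Rightarrow>\<^sub>0 real"
  assumes "x \<noteq> y"
  obtains \<phi> where "continuous_on UNIV \<phi>" "lin_ext \<phi> x \<noteq> lin_ext \<phi> y"
proof -
  obtain u where u: "Poly_Mapping.lookup x u \<noteq> Poly_Mapping.lookup y u"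
    using assms by (metis poly_mapping_eqI)
  define S where "S = Poly_Mapping.keys x \<union> Poly_Mapping.keys y"
  have S: "finite S" "u \<in> S"
    using u unfolding S_def by (auto simp: in_keys_iff)
  \<comment> \<open>The product of the distances to the other support points is continuous and
    vanishes at exactly those points, so the functional reads off the coefficient at
    \<open>u\<close> up to the factor \<open>\<phi> u\<close>.\<close>
  define \<phi> where "\<phi> v = (\<Prod>w\<in>S - {u}. dist v w)" for v
  have \<phi>0: "\<phi> w = 0" if "w \<in> S - {u}" for w
    using that S(1) unfolding \<phi>_def by (intro prod_zero) auto
  have \<phi>u: "\<phi> u \<noteq> 0"
    using S(1) unfolding \<phi>_def by auto
  have eq: "lin_ext \<phi> z = Poly_Mapping.lookup z u * \<phi> u" if "Poly_Mapping.keys z \<subseteq> S" for z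
    unfolding lin_ext_superset[OF S(1) that] sum.remove[OF S] using \<phi>0 by (simp add: sum.neutral)
  have "continuous_on UNIV \<phi>"
    unfolding \<phi>_def by (intro continuous_intros)
  moreover have "lin_ext \<phi> x \<noteq> lin_ext \<phi> y"
    using eq[of x] eq[of y] u \<phi>u by (simp add: S_def)
  ultimately show thesis
    by (rule that)
qed

lemma Hausdorff_free_topology:
  assumes U: "openin (Euclidean_space m) U"
  shows "Hausdorff_space (free_topology m U)"
  unfolding Hausdorff_space_def
proof (intro allI impI, elim conjE)
  let ?T = "free_topology m U"
  fix x y assume x: "x \<in> topspace ?T" and y: "y \<in> topspace ?T" and "x \<noteq> y"
  obtain \<phi> where \<phi>: "continuous_on UNIV \<phi>" "lin_ext \<phi> x \<noteq> lin_ext \<phi> y"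
    using lin_ext_separates[OF \<open>x \<noteq> y\<close>] by blast
  \<comment> \<open>The type class topology on sequences is the product topology, of which
    \<open>Euclidean_space m\<close> is a subspace.\<close>
  have "continuous_map (subtopology (Euclidean_space m) U) euclideanreal \<phi>"
    unfolding Euclidean_space_def euclidean_product_topology
    using \<phi>(1) by (intro continuous_map_from_subtopology) simp
  note cont = continuous_map_lin_ext[OF U this]
  obtain A B where AB: "open A" "open B" "lin_ext \<phi> x \<in> A" "lin_ext \<phi> y \<in> B" "A \<inter> B = {}"
    using hausdorff[OF \<phi>(2)] by blast
  let ?P = "\<lambda>A. {z \<in> topspace ?T. lin_ext \<phi> z \<in> A}"
  have "openin ?T (?P A)" "openin ?T (?P B)"
    using AB by (auto intro: openin_continuous_map_preimage[OF cont])
  moreover have "x \<in> ?P A" "y \<in> ?P B" "disjnt (?P A) (?P B)"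
    using AB x y by (auto simp: disjnt_def)
  ultimately show "\<exists>V W. openin ?T V \<and> openin ?T W \<and> x \<in> V \<and> y \<in> W \<and> disjnt V W"
    by blast
qed

section \<open>Continuity of addition and scaling\<close>

text \<open>The combination factors as \<open>encode\<close> followed by \<open>comb m N\<close>.
  Since \<open>X\<close> is arbitrary, both operations can be treated on product spaces.\<close>

lemma continuous_map_comb_encode:
  fixes N :: nat
  assumes U: "openin (Euclidean_space m) U"
    and r: "\<And>i. i < N \<Longrightarrow> continuous_map X euclideanreal (\<lambda>x. r x i)"
    and q: "\<And>i. i < N \<Longrightarrow> continuous_map X (subtopology (Euclidean_space m) U) (\<lambda>x. q x i)"
  shows "continuous_map X (free_topology m U) (\<lambda>x. \<Sum>i<N. r x i *\<^sub>R basis_vector (q x i))"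
proof -
  have cont: "continuous_map X (free_topology m U) (\<lambda>x. comb m N (encode m N (r x) (q x)))"
    using continuous_map_compose[OF continuous_map_encode[OF openin_subset[OF U] r q] continuous_map_comb[OF U]]
    by (simp add: o_def)
  have eq: "comb m N (encode m N (r x) (q x)) = (\<Sum>i<N. r x i *\<^sub>R basis_vector (q x i))"
    if "x \<in> topspace X" for x
  proof (rule comb_encode)
    show "q x i \<in> topspace (Euclidean_space m)" if "i < N" for i
      using continuous_map_image_subset_topspace[OF q[OF that]] \<open>x \<in> topspace X\<close> by auto
  qed
  show ?thesis
    by (rule continuous_map_eq[OF cont eq])
qed

lemma continuous_map_add_comb:
  assumes U: "openin (Euclidean_space m) U"
  shows "continuous_map (prod_topology (comb_space m U M) (comb_space m U N)) (free_topology m U)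
    (\<lambda>(a, b). comb m M a + comb m N b)"
proof -
  let ?X = "prod_topology (comb_space m U M) (comb_space m U N)"
  \<comment> \<open>The sum of two combinations is their concatenation: the first \<open>M\<close>
    terms come from the left factor, the others from the right one with index shifted by
    \<open>M\<close>.\<close>
  define r where "r p i = (if i < M then fst p (i * Suc m) else snd p ((i - M) * Suc m))"
    for p :: "(nat \<Rightarrow> real) \<times> (nat \<Rightarrow> real)" and i
  define q where "q p i = (if i < M then block_point m (fst p) i else block_point m (snd p) (i - M))"
    for p i
  note fst = continuous_map_compose[OF continuous_map_fst, unfolded o_def]
    and snd = continuous_map_compose[OF continuous_map_snd, unfolded o_def]
  have "continuous_map ?X (free_topology m U) (\<lambda>p. \<Sum>i<M + N. r p i *\<^sub>R basis_vector (q p i))"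
  proof (rule continuous_map_comb_encode[OF U])
    fix i assume i: "i < M + N"
    show "continuous_map ?X euclideanreal (\<lambda>p. r p i)"
      using fst[OF comb_space_coefficients] snd[OF comb_space_coefficients]
      by (cases "i < M") (simp_all only: r_def if_True if_False)
    show "continuous_map ?X (subtopology (Euclidean_space m) U) (\<lambda>p. q p i)"
    proof (cases "i < M")
      case True
      then show ?thesis
        using fst[OF comb_space_points[OF True]] by (simp only: q_def if_True)
    next
      case False
      then have "i - M < N"
        using i by simp
      then show ?thesis
        using False snd[OF comb_space_points[OF \<open>i - M < N\<close>]] by (simp only: q_def if_False)
    qed
  qed
  moreover have "(\<Sum>i<M + N. r p i *\<^sub>R basis_vector (q p i)) = comb m M (fst p) + comb m N (snd p)" for p
    unfolding sum_lessThan_add comb_def by (simp add: r_def q_def)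
  ultimately show ?thesis
    by (simp add: case_prod_beta')
qed

lemma continuous_map_scaleR_comb:
  assumes U: "openin (Euclidean_space m) U"
  shows "continuous_map (prod_topology euclideanreal (comb_space m U N)) (free_topology m U)
    (\<lambda>(c, a). c *\<^sub>R comb m N a)"
proof -
  let ?X = "prod_topology euclideanreal (comb_space m U N)"
  note snd = continuous_map_compose[OF continuous_map_snd, unfolded o_def]
  have "continuous_map ?X (free_topology m U)
      (\<lambda>p. \<Sum>i<N. (fst p * snd p (i * Suc m)) *\<^sub>R basis_vector (block_point m (snd p) i))"
    by (intro continuous_map_comb_encode[OF U] continuous_map_real_mult continuous_map_fst
        snd[OF comb_space_coefficients] snd[OF comb_space_points])
  then show ?thesis
    by (simp add: case_prod_beta' comb_def scaleR_sum_right)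
qed

text \<open>Lets the real line enter the product theorem as a cover of itself, so that scaling is
  handled like addition.\<close>

lemma quotient_cover_id: "quotient_cover T (\<lambda>_. T) (\<lambda>_ x. x)"
  unfolding quotient_cover_def
proof (intro conjI allI impI)
  fix A assume "A \<subseteq> topspace T" "\<forall>i::nat. openin T {y \<in> topspace T. y \<in> A}"
  moreover have "{y \<in> topspace T. y \<in> A} = topspace T \<inter> A"
    by blast
  ultimately show "openin T A"
    by (simp add: Int_absorb1)
qed auto

text \<open>Both operations are pulled back by \<open>continuous_map_prod_quotient_cover\<close> to
  products with combination spaces, where they are again combinations with continuous data.\<close>

theorem topological_vector_space_free_topology:
  assumes U: "openin (Euclidean_space m) U"
  shows "topological_vector_space (free_topology m U)"
  unfolding topological_vector_space_def
proof (intro conjI)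
  note F = free_topology_quotient_cover[OF U] Hausdorff_free_topology[OF U]
    locally_compact_comb_space[OF U] Lindelof_comb_space
  show "subspace (topspace (free_topology m U))"
    unfolding topspace_free_topology[OF U] by (rule subspace_free_vector_space)
  show "continuous_map (prod_topology (free_topology m U) (free_topology m U)) (free_topology m U)
      (\<lambda>(x, y). x + y)"
    using continuous_map_add_comb[OF U]
    by (intro continuous_map_prod_quotient_cover[OF F F]) (simp add: case_prod_beta')
  have R: "locally_compact_space euclideanreal" "Lindelof_space euclideanreal"
  proof -
    show "locally_compact_space euclideanreal"
      by (rule locally_compact_space_euclidean)
    show "Lindelof_space euclideanreal"
      using Lindelof_openin[of _ "UNIV :: real set"] unfolding Lindelof_space_def
      by (metis subtopology_UNIV)
  qed
  show "continuous_map (prod_topology euclideanreal (free_topology m U)) (free_topology m U)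
      (\<lambda>(c, x). c *\<^sub>R x)"
    using continuous_map_scaleR_comb[OF U]
    by (intro continuous_map_prod_quotient_cover[OF quotient_cover_id _ R F]) (simp_all add: case_prod_beta')
qed

text \<open>\<open>normal_space\<close> by itself does not separate points, so the Hausdorff
  property is stated beside it.\<close>

theorem theorem7p6:
  fixes m :: nat and U :: "(nat \<Rightarrow> real) set"
  assumes "openin (Euclidean_space m) U"
  shows "topological_vector_space (D_topology (free_vector_space U) (free_plot m U)) \<and>
         Hausdorff_space (D_topology (free_vector_space U) (free_plot m U)) \<and>
         normal_space (D_topology (free_vector_space U) (free_plot m U))"
proof (intro conjI)
  show tvs: "topological_vector_space (free_topology m U)"
    by (rule topological_vector_space_free_topology[OF assms])
  show "Hausdorff_space (free_topology m U)"
    by (rule Hausdorff_free_topology[OF assms])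
  show "normal_space (free_topology m U)"
    using topological_vector_space_imp_regular[OF tvs]
      quotient_cover_Lindelof[OF free_topology_quotient_cover[OF assms] Lindelof_comb_space]
    by (rule regular_Lindelof_imp_normal_space)
qed

end
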